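(* Let $p\ge 2$, let $\psi=(\psi_{ij})$ be a smooth symmetric $2$-tensor field on $\mathbb{R}^p$, and let $(M,g_\psi)$ be the pseudo-Riemannian manifold $M=\mathbb{R}^{2p}$ of signature $(p,p)$ defined in the context. Then: (1) $(M,g_\psi)$ is $k$ Osserman for every admissible $k$, i.e. for every integer $k$ with $1\le k\le 2p-1$. (2) If $\psi\in\Psi$ (see context), then: (a) $(M,g_\psi)$ is Jordan Osserman of types $(0,r)$, $(p,p-r)$, $(r,0)$ and $(p-r,p)$ for every integer $r$ with $0<r\le p$; (b) $(M,g_\psi)$ is not Jordan Osserman of type $(r,s)$ whenever $0<r<p$ and $0<s<p$.
   Context: Conventions. A pseudo-Riemannian manifold of signature $(p,q)$ has a metric $(\cdot,\cdot)=g$ with $p$ negative (timelike) and $q$ positive (spacelike) directions; $m=p+q$ is its dimension. The curvature operator of the Levi-Civita connection is $R(Z_1,Z_2)=\nabla_{Z_1}\nabla_{Z_2}-\nabla_{Z_2}\nabla_{Z_1}-\nabla_{[Z_1,Z_2]}$, and the Jacobi operator is $J(X):Y\mapsto R(Y,X)X$, a self-adjoint operator on each tangent space. Higher order Jacobi operator. A pair of integers $(r,s)$ is admissible for signature $(p,q)$ if $0\le r\le p$, $0\le s\le q$ and $1\le r+s\le m-1$. $\mathrm{Gr}_{r,s}(M,g)$ is the bundle over $M$ of all non-degenerate subspaces of signature $(r,s)$ ($r$ timelike and $s$ spacelike directions) of the tangent spaces of $M$. For $\pi\in\mathrm{Gr}_{r,s}(M,g)$ with orthonormal basis $\{e_1,\dots,e_{r+s}\}$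 put $J(\pi):=\sum_{i=1}^{r+s}(e_i,e_i)J(e_i)$; this does not depend on the orthonormal basis. Osserman conditions. $(M,g)$ is Osserman of type $(r,s)$ if the eigenvalues of $J(\pi)$ are constant as $\pi$ ranges over the whole bundle $\mathrm{Gr}_{r,s}(M,g)$. $(M,g)$ is Jordan Osserman of type $(r,s)$ if the Jordan normal form (conjugacy class) of $J(\pi)$ is constant as $\pi$ ranges over $\mathrm{Gr}_{r,s}(M,g)$. $(M,g)$ is $k$ Osserman if it is Osserman of type $(r,s)$ for all admissible $(r,s)$ with $r+s=k$ or $r+s=m-k$ (it is known that this holds for all such $(r,s)$ as soon as it holds for one). The manifold $(M,g_\psi)$. Let $M=\mathbb{R}^{2p}$ with coordinates $(x,y)=(x_1,\dots,x_p,y_1,\dots,y_p)$, coordinate vector fields $\partial_i^x,\partial_i^y$, and $\mathcal{X}=\mathrm{span}\{\partial_i^x\}_{1\le i\le p}$. For a smooth symmetric $2$-tensor $\psi$ on $\mathbb{R}^p$ with components $\psi_{ij}(x)=\psi(\partial_i^x,\partial_j^x)$, the metric $g_\psi$ of signature $(p,p)$ is given by $$g_\psi(\partial_i^x,\partial_j^y)=\delta_{ij},\quad g_\psi(\partial_i^y,\partial_j^y)=0,\quad g_\psi(\partial_i^x,\partial_j^x)=\psi_{ij}(x).$$ The set $\Psi$. A self-adjoint operator $A$ is called positive semi-definite if the form $(Z_1,Z_2)\mapsto (AZ_1,Z_2)$ is positive semi-definite. $\Psi$ is the set of all smooth symmetric $2$-tensor fields $\psi$ on $\mathbb{R}^p$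 such that, at every point of $(M,g_\psi)$, the Jacobi operator $J(X)$ is positive semi-definite of rank $p-1$ for every nonzero $X\in\mathcal{X}$. *)

theory Defs
  imports "HOL-Analysis.Analysis" "HOL-Computational_Algebra.Polynomial"
begin

section \<open>Smooth maps\<close>

primrec Ck :: "nat \<Rightarrow> ('a::real_normed_vector \<Rightarrow> 'b::real_normed_vector) \<Rightarrow> bool" where
  "Ck 0 f \<longleftrightarrow> continuous_on UNIV f"
| "Ck (Suc k) f \<longleftrightarrow>
     (\<forall>x. f differentiable (at x)) \<and> (\<forall>v. Ck k (\<lambda>x. frechet_derivative f (at x) v))"

definition smooth :: "('a::real_normed_vector \<Rightarrow> 'b::real_normed_vector) \<Rightarrow> bool" where
  "smooth f \<longleftrightarrow> (\<forall>k. Ck k f)"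

section \<open>Pseudo-Riemannian geometry of \<open>\<real>\<^sup>m\<close> in global coordinates\<close>

text \<open>
  Every tangent space of \<open>\<real>\<^sup>m\<close> is identified with \<open>\<real>\<^sup>m\<close> by means of the coordinate frame
  (\<open>axis i 1\<close> is the \<open>i\<close>-th coordinate vector field). A metric is its matrix of components
  \<open>g x $ i $ j = g(\<partial>\<^sub>i, \<partial>\<^sub>j)(x)\<close>, and a vector field is its component function.
\<close>

type_synonym 'm metric = "real^'m \<Rightarrow> real^'m^'m"

type_synonym 'm vfield = "real^'m \<Rightarrow> real^'m"

definition gprod :: "'m::finite metric \<Rightarrow> real^'m \<Rightarrow> real^'m \<Rightarrow> real^'m \<Rightarrow> real" where
  "gprod g x u v = u \<bullet> (g x *v v)"

definition nondegenerate_on :: "'m::finite metric \<Rightarrow> real^'m \<Rightarrow> (real^'m) set \<Rightarrow> bool" where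
  "nondegenerate_on g x V \<longleftrightarrow> (\<forall>u\<in>V. (\<forall>v\<in>V. gprod g x u v = 0) \<longrightarrow> u = 0)"

definition orthonormal_basis ::
    "'m::finite metric \<Rightarrow> real^'m \<Rightarrow> (real^'m) set \<Rightarrow> (real^'m) set \<Rightarrow> bool" where
  "orthonormal_basis g x V B \<longleftrightarrow>
     independent B \<and> span B = V \<and>
     (\<forall>u\<in>B. gprod g x u u = 1 \<or> gprod g x u u = - 1) \<and>
     (\<forall>u\<in>B. \<forall>v\<in>B. u \<noteq> v \<longrightarrow> gprod g x u v = 0)"

text \<open>The fibre over \<open>x\<close> of the bundle of non-degenerate subspaces of signature \<open>(r,s)\<close>:
  \<open>r\<close> timelike (negative) and \<open>s\<close> spacelike (positive) directions.\<close>

definition Gr :: "'m::finite metric \<Rightarrow> nat \<Rightarrow> nat \<Rightarrow> real^'m \<Rightarrow> (real^'m) set set" where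
  "Gr g r s x =
     {V. subspace V \<and> nondegenerate_on g x V \<and>
         (\<exists>B. orthonormal_basis g x V B \<and>
              card {e\<in>B. gprod g x e e < 0} = r \<and> card {e\<in>B. gprod g x e e > 0} = s)}"

definition pseudo_riemannian :: "nat \<Rightarrow> nat \<Rightarrow> 'm::finite metric \<Rightarrow> bool" where
  "pseudo_riemannian p q g \<longleftrightarrow>
     smooth g \<and> (\<forall>x. transpose (g x) = g x) \<and> (\<forall>x. UNIV \<in> Gr g p q x)"

definition partial :: "'m::finite \<Rightarrow> (real^'m \<Rightarrow> real) \<Rightarrow> real^'m \<Rightarrow> real" where
  "partial i f x = frechet_derivative f (at x) (axis i 1)"

text \<open>The Christoffel symbol with upper index \<open>k\<close> and lower indices \<open>i\<close>, \<open>j\<close>.\<close>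

definition christoffel :: "'m::finite metric \<Rightarrow> real^'m \<Rightarrow> 'm \<Rightarrow> 'm \<Rightarrow> 'm \<Rightarrow> real" where
  "christoffel g x k i j =
     (1/2) * (\<Sum>l\<in>UNIV. matrix_inv (g x) $ k $ l *
        (partial i (\<lambda>y. g y $ j $ l) x + partial j (\<lambda>y. g y $ i $ l) x
          - partial l (\<lambda>y. g y $ i $ j) x))"

text \<open>The Levi-Civita connection; \<open>nabla_torsion_free\<close> and \<open>nabla_metric\<close> below show that
  it is torsion free and compatible with the metric.\<close>

definition nabla :: "'m::finite metric \<Rightarrow> 'm vfield \<Rightarrow> 'm vfield \<Rightarrow> 'm vfield" where
  "nabla g X Y x =
     frechet_derivative Y (at x) (X x)
       + (\<chi> k. \<Sum>i\<in>UNIV. \<Sum>j\<in>UNIV. christoffel g x k i j * X x $ i * Y x $ j)"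

definition lie_bracket :: "'m::finite vfield \<Rightarrow> 'm vfield \<Rightarrow> 'm vfield" where
  "lie_bracket X Y x =
     frechet_derivative Y (at x) (X x) - frechet_derivative X (at x) (Y x)"

definition curvature ::
    "'m::finite metric \<Rightarrow> 'm vfield \<Rightarrow> 'm vfield \<Rightarrow> 'm vfield \<Rightarrow> 'm vfield" where
  "curvature g X Y Z x =
     nabla g X (nabla g Y Z) x - nabla g Y (nabla g X Z) x - nabla g (lie_bracket X Y) Z x"

text \<open>The curvature is tensorial, so its value at a point on tangent vectors may be computed
  from any extensions to vector fields; we take the ones with constant components.\<close>

definition curv_at ::
    "'m::finite metric \<Rightarrow> real^'m \<Rightarrow> real^'m \<Rightarrow> real^'m \<Rightarrow> real^'m \<Rightarrow> real^'m" where
  "curv_at g x u v w = curvature g (\<lambda>_. u) (\<lambda>_. v) (\<lambda>_. w) x"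

definition jacobi :: "'m::finite metric \<Rightarrow> real^'m \<Rightarrow> real^'m \<Rightarrow> real^'m \<Rightarrow> real^'m" where
  "jacobi g x X Y = curv_at g x Y X X"

text \<open>The sum does not depend on the orthonormal basis, so an arbitrary one is chosen.\<close>

definition jacobi_sub ::
    "'m::finite metric \<Rightarrow> real^'m \<Rightarrow> (real^'m) set \<Rightarrow> real^'m \<Rightarrow> real^'m" where
  "jacobi_sub g x V Y =
     (\<Sum>e\<in>(SOME B. orthonormal_basis g x V B). gprod g x e e *\<^sub>R jacobi g x e Y)"

section \<open>Osserman conditions\<close>

definition charpoly :: "(real^'m::finite \<Rightarrow> real^'m) \<Rightarrow> complex poly" where
  "charpoly A = det (mat [:0, 1:] - (\<chi> i j. [:complex_of_real (matrix A $ i $ j):]))"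

text \<open>Complex eigenvalues of a real operator, with algebraic multiplicity: an operator that is
  self-adjoint for an indefinite metric need not have real eigenvalues.\<close>

definition eigenvalues :: "(real^'m::finite \<Rightarrow> real^'m) \<Rightarrow> complex multiset" where
  "eigenvalues A = proots (charpoly A)"

text \<open>Equality of conjugacy classes. It is stated over the reals; two real operators are
  conjugate over the reals iff they are so over the complex numbers, i.e. iff they have the same
  Jordan normal form.\<close>

definition conjugate :: "(real^'m::finite \<Rightarrow> real^'m) \<Rightarrow> (real^'m \<Rightarrow> real^'m) \<Rightarrow> bool" where
  "conjugate A B \<longleftrightarrow> (\<exists>T. linear T \<and> bij T \<and> T \<circ> A = B \<circ> T)"

definition admissible :: "nat \<Rightarrow> nat \<Rightarrow> nat \<Rightarrow> nat \<Rightarrow> bool" where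
  "admissible p q r s \<longleftrightarrow> r \<le> p \<and> s \<le> q \<and> 1 \<le> r + s \<and> r + s \<le> p + q - 1"

definition osserman :: "'m::finite metric \<Rightarrow> nat \<Rightarrow> nat \<Rightarrow> bool" where
  "osserman g r s \<longleftrightarrow>
     (\<forall>x y. \<forall>V\<in>Gr g r s x. \<forall>W\<in>Gr g r s y.
        eigenvalues (jacobi_sub g x V) = eigenvalues (jacobi_sub g y W))"

definition jordan_osserman :: "'m::finite metric \<Rightarrow> nat \<Rightarrow> nat \<Rightarrow> bool" where
  "jordan_osserman g r s \<longleftrightarrow>
     (\<forall>x y. \<forall>V\<in>Gr g r s x. \<forall>W\<in>Gr g r s y.
        conjugate (jacobi_sub g x V) (jacobi_sub g y W))"

text \<open>Here \<open>(p,q)\<close> is the signature of \<open>g\<close>.\<close>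

definition k_osserman :: "nat \<Rightarrow> nat \<Rightarrow> 'm::finite metric \<Rightarrow> nat \<Rightarrow> bool" where
  "k_osserman p q g k \<longleftrightarrow>
     (\<forall>r s. admissible p q r s \<and> (r + s = k \<or> r + s = p + q - k) \<longrightarrow> osserman g r s)"

section \<open>The manifolds \<open>(M, g\<^sub>\<psi>)\<close>\<close>

text \<open>Here \<open>p = CARD('n)\<close> and \<open>M = real^('n + 'n)\<close>; the indices \<open>Inl i\<close> belong to the coordinates
  \<open>x\<^sub>i\<close> and the indices \<open>Inr i\<close> to the coordinates \<open>y\<^sub>i\<close>.\<close>

definition xpart :: "real^('n::finite + 'n) \<Rightarrow> real^'n" where
  "xpart z = (\<chi> i. z $ Inl i)"

definition g_psi :: "(real^'n::finite \<Rightarrow> real^'n^'n) \<Rightarrow> ('n + 'n) metric" where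
  "g_psi \<psi> z = (\<chi> a b. case (a, b) of
       (Inl i, Inl j) \<Rightarrow> \<psi> (xpart z) $ i $ j
     | (Inl i, Inr j) \<Rightarrow> (if i = j then 1 else 0)
     | (Inr i, Inl j) \<Rightarrow> (if i = j then 1 else 0)
     | (Inr i, Inr j) \<Rightarrow> 0)"

definition smooth_sym2_tensor :: "(real^'n::finite \<Rightarrow> real^'n^'n) \<Rightarrow> bool" where
  "smooth_sym2_tensor \<psi> \<longleftrightarrow> smooth \<psi> \<and> (\<forall>x. transpose (\<psi> x) = \<psi> x)"

definition X_space :: "(real^('n::finite + 'n)) set" where
  "X_space = span (range (\<lambda>i. axis (Inl i) 1))"

definition pos_semidef ::
    "'m::finite metric \<Rightarrow> real^'m \<Rightarrow> (real^'m \<Rightarrow> real^'m) \<Rightarrow> bool" where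
  "pos_semidef g x A \<longleftrightarrow> (\<forall>Z. 0 \<le> gprod g x (A Z) Z)"

definition Psi :: "(real^'n::finite \<Rightarrow> real^'n^'n) set" where
  "Psi = {\<psi>. smooth_sym2_tensor \<psi> \<and>
     (\<forall>z. \<forall>X\<in>X_space. X \<noteq> 0 \<longrightarrow>
        pos_semidef (g_psi \<psi>) z (jacobi (g_psi \<psi>) z X) \<and>
        dim (range (jacobi (g_psi \<psi>) z X)) = CARD('n) - 1)}"

section \<open>Basic properties of the connection and of \<open>g\<^sub>\<psi>\<close>\<close>

lemma symmetric_nth:
  assumes "transpose A = A"
  shows "A $ i $ j = A $ j $ i"
  using arg_cong[OF assms, of "\<lambda>M. M $ i $ j"] by (simp add: transpose_def)

lemma christoffel_sym:
  assumes "\<And>x. transpose (g x) = g x"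
  shows "christoffel g x k i j = christoffel g x k j i"
proof -
  have "g y $ i $ j = g y $ j $ i" for y
    by (rule symmetric_nth[OF assms])
  then show ?thesis
    by (simp add: christoffel_def add.commute)
qed

theorem nabla_torsion_free:
  assumes "\<And>x. transpose (g x) = g x"
  shows "nabla g X Y x - nabla g Y X x = lie_bracket X Y x"
proof -
  have "(\<Sum>i\<in>UNIV. \<Sum>j\<in>UNIV. christoffel g x k i j * X x $ i * Y x $ j)
      = (\<Sum>i\<in>UNIV. \<Sum>j\<in>UNIV. christoffel g x k i j * Y x $ i * X x $ j)" for k
    by (subst sum.swap) (simp add: christoffel_sym[OF assms, of _ _ k] mult_ac)
  then show ?thesis
    by (simp add: nabla_def lie_bracket_def)
qed

lemma g_christoffel:
  assumes "\<And>x. transpose (g x) = g x" and "invertible (g x)"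
  shows "(\<Sum>k\<in>UNIV. g x $ m $ k * christoffel g x k i j) =
     (1/2) * (partial i (\<lambda>y. g y $ j $ m) x + partial j (\<lambda>y. g y $ i $ m) x
          - partial m (\<lambda>y. g y $ i $ j) x)"
proof -
  define F where "F l = partial i (\<lambda>y. g y $ j $ l) x + partial j (\<lambda>y. g y $ i $ l) x
          - partial l (\<lambda>y. g y $ i $ j) x" for l
  have "g x ** matrix_inv (g x) = mat 1"
    using assms(2) unfolding invertible_def matrix_inv_def by (metis (mono_tags, lifting) someI_ex)
  then have inv: "(\<Sum>k\<in>UNIV. g x $ m $ k * matrix_inv (g x) $ k $ l) = (if m = l then 1 else 0)" for l
    by (simp add: matrix_matrix_mult_def mat_def vec_eq_iff)
  have "(\<Sum>k\<in>UNIV. g x $ m $ k * christoffel g x k i j)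
      = (\<Sum>k\<in>UNIV. \<Sum>l\<in>UNIV. (1/2) * F l * (g x $ m $ k * matrix_inv (g x) $ k $ l))"
    by (simp add: christoffel_def F_def sum_distrib_left mult_ac)
  also have "\<dots> = (\<Sum>l\<in>UNIV. (1/2) * F l * (\<Sum>k\<in>UNIV. g x $ m $ k * matrix_inv (g x) $ k $ l))"
    by (subst sum.swap) (simp add: sum_distrib_left)
  also have "\<dots> = (1/2) * F m"
    by (simp add: inv if_distrib cong: if_cong)
  finally show ?thesis by (simp add: F_def)
qed

theorem nabla_metric:
  assumes sym: "\<And>x. transpose (g x) = g x" and inv: "invertible (g x)"
    and dg: "g differentiable (at x)"
    and dY: "Y differentiable (at x)" and dZ: "Z differentiable (at x)"
  shows "frechet_derivative (\<lambda>y. gprod g y (Y y) (Z y)) (at x) (X x) =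
     gprod g x (nabla g X Y x) (Z x) + gprod g x (Y x) (nabla g X Z x)"
proof -
  let ?G = "frechet_derivative g (at x)" and ?Y = "frechet_derivative Y (at x)"
    and ?Z = "frechet_derivative Z (at x)"
  have G: "(g has_derivative ?G) (at x)" and Y': "(Y has_derivative ?Y) (at x)"
    and Z': "(Z has_derivative ?Z) (at x)"
    using dg dY dZ by (simp_all add: frechet_derivative_works[symmetric])
  have gs: "g y $ i $ j = g y $ j $ i" for y i j
    by (rule symmetric_nth[OF sym])
  have comp: "((\<lambda>y. g y $ i $ j) has_derivative (\<lambda>v. ?G v $ i $ j)) (at x)" for i j
    using G by (intro bounded_linear.has_derivative[OF bounded_linear_vec_nth])
  have part: "partial k (\<lambda>y. g y $ i $ j) x = ?G (axis k 1) $ i $ j" for i j k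
    unfolding partial_def using frechet_derivative_at[OF comp] by metis
  have lin: "linear ?G" using G has_derivative_linear by blast
  have GX: "?G (X x) $ i $ j = (\<Sum>k\<in>UNIV. X x $ k * partial k (\<lambda>y. g y $ i $ j) x)" for i j
  proof -
    have "X x = (\<Sum>k\<in>UNIV. X x $ k *\<^sub>R axis k 1)"
      using basis_expansion[of "X x"] by (simp add: scalar_mult_eq_scaleR)
    then have "?G (X x) = ?G (\<Sum>k\<in>UNIV. X x $ k *\<^sub>R axis k 1)"
      by (rule arg_cong)
    also have "\<dots> = (\<Sum>k\<in>UNIV. X x $ k *\<^sub>R ?G (axis k 1))"
      by (simp only: linear_sum[OF lin] linear_cmul[OF lin])
    finally have "?G (X x) = (\<Sum>k\<in>UNIV. X x $ k *\<^sub>R ?G (axis k 1))" .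
    then show ?thesis by (simp add: part)
  qed
  have gp: "gprod g y u v = (\<Sum>i\<in>UNIV. \<Sum>j\<in>UNIV. u $ i * (g y $ i $ j * v $ j))" for y u v
    by (simp add: gprod_def inner_vec_def matrix_vector_mult_def sum_distrib_left)
  have gpsym: "gprod g y u v = gprod g y v u" for y u v
    unfolding gp by (subst sum.swap) (simp add: gs mult_ac)
  have nth: "((\<lambda>y. V y $ i) has_derivative (\<lambda>v. V' v $ i)) (at x)" if "(V has_derivative V') (at x)"
    for V V' i
    using that by (intro bounded_linear.has_derivative[OF bounded_linear_vec_nth])
  have D: "((\<lambda>y. gprod g y (Y y) (Z y)) has_derivative
     (\<lambda>v. \<Sum>i\<in>UNIV. \<Sum>j\<in>UNIV. Y x $ i * (g x $ i $ j * ?Z v $ j + ?G v $ i $ j * Z x $ j)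
         + ?Y v $ i * (g x $ i $ j * Z x $ j))) (at x)"
    unfolding gp by (intro has_derivative_sum has_derivative_mult comp nth[OF Y'] nth[OF Z'])
  have L: "frechet_derivative (\<lambda>y. gprod g y (Y y) (Z y)) (at x) (X x) =
      gprod g x (?Y (X x)) (Z x) + gprod g x (Y x) (?Z (X x))
      + (\<Sum>i\<in>UNIV. \<Sum>j\<in>UNIV. Y x $ i * (?G (X x) $ i $ j * Z x $ j))"
    unfolding frechet_derivative_at[OF D, symmetric] unfolding gp
    by (simp add: sum.distrib algebra_simps)
  define C where "C W = (\<chi> k. \<Sum>i\<in>UNIV. \<Sum>j\<in>UNIV. christoffel g x k i j * X x $ i * W $ j)" for W
  define E where "E i j m = (1/2) * (partial i (\<lambda>y. g y $ j $ m) x + partial j (\<lambda>y. g y $ i $ m) x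
          - partial m (\<lambda>y. g y $ i $ j) x)" for i j m
  have Es: "E i j m = (\<Sum>k\<in>UNIV. g x $ m $ k * christoffel g x k i j)" for i j m
    unfolding E_def by (rule g_christoffel[where g = g, OF sym inv, symmetric])
  have gC: "gprod g x V (C W) = (\<Sum>m\<in>UNIV. \<Sum>j\<in>UNIV. \<Sum>i\<in>UNIV. V $ m * W $ j * X x $ i * E i j m)" for V W
  proof -
    have "(g x *v C W) $ m = (\<Sum>j\<in>UNIV. \<Sum>i\<in>UNIV. W $ j * X x $ i * E i j m)" for m
    proof -
      have "(g x *v C W) $ m = (\<Sum>k\<in>UNIV. \<Sum>i\<in>UNIV. \<Sum>j\<in>UNIV. (W $ j * X x $ i) * (g x $ m $ k * christoffel g x k i j))"
        by (simp add: matrix_vector_mult_def C_def sum_distrib_left mult_ac)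
      also have "\<dots> = (\<Sum>i\<in>UNIV. \<Sum>k\<in>UNIV. \<Sum>j\<in>UNIV. (W $ j * X x $ i) * (g x $ m $ k * christoffel g x k i j))"
        by (rule sum.swap)
      also have "\<dots> = (\<Sum>i\<in>UNIV. \<Sum>j\<in>UNIV. \<Sum>k\<in>UNIV. (W $ j * X x $ i) * (g x $ m $ k * christoffel g x k i j))"
        by (intro sum.cong refl sum.swap)
      also have "\<dots> = (\<Sum>i\<in>UNIV. \<Sum>j\<in>UNIV. W $ j * X x $ i * E i j m)"
        by (simp add: Es sum_distrib_left)
      also have "\<dots> = (\<Sum>j\<in>UNIV. \<Sum>i\<in>UNIV. W $ j * X x $ i * E i j m)" by (rule sum.swap)
      finally show ?thesis .
    qed
    then show ?thesis by (simp add: gprod_def inner_vec_def sum_distrib_left mult_ac)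
  qed
  have EE: "E i j m + E i m j = partial i (\<lambda>y. g y $ j $ m) x" for i j m
    by (simp add: E_def gs[of _ m j] field_simps)
  have "gprod g x (Z x) (C (Y x)) + gprod g x (Y x) (C (Z x))
      = (\<Sum>j\<in>UNIV. \<Sum>m\<in>UNIV. \<Sum>i\<in>UNIV. Z x $ m * Y x $ j * X x $ i * E i j m)
      + (\<Sum>j\<in>UNIV. \<Sum>m\<in>UNIV. \<Sum>i\<in>UNIV. Z x $ m * Y x $ j * X x $ i * E i m j)"
    unfolding gC by (subst sum.swap) (simp add: mult_ac)
  also have "\<dots> = (\<Sum>j\<in>UNIV. \<Sum>m\<in>UNIV. \<Sum>i\<in>UNIV. Z x $ m * Y x $ j * X x $ i * (E i j m + E i m j))"
    by (simp add: sum.distrib distrib_left)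
  also have "\<dots> = (\<Sum>i\<in>UNIV. \<Sum>j\<in>UNIV. Y x $ i * (?G (X x) $ i $ j * Z x $ j))"
    unfolding EE GX by (simp add: sum_distrib_left sum_distrib_right mult_ac)
  finally have K: "gprod g x (Z x) (C (Y x)) + gprod g x (Y x) (C (Z x)) = \<dots>" .
  have add: "gprod g x u (v + w) = gprod g x u v + gprod g x u w" for u v w
    by (simp add: gprod_def matrix_vector_right_distrib inner_add_right)
  have "gprod g x (nabla g X Y x) (Z x) + gprod g x (Y x) (nabla g X Z x)
     = gprod g x (Z x) (?Y (X x) + C (Y x)) + gprod g x (Y x) (?Z (X x) + C (Z x))"
    by (simp add: gpsym[of _ _ "Z x"] nabla_def C_def)
  also have "\<dots> = gprod g x (?Y (X x)) (Z x) + gprod g x (Y x) (?Z (X x))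
     + (gprod g x (Z x) (C (Y x)) + gprod g x (Y x) (C (Z x)))"
    by (simp add: add gpsym[of _ "?Y (X x)" "Z x"])
  finally show ?thesis unfolding L K by simp
qed

lemma Ck_linear_comp:
  assumes "bounded_linear T" "bounded_linear L"
  shows "Ck n f \<Longrightarrow> Ck n (\<lambda>x. T (f (L x)) + c)"
proof (induction n arbitrary: f c)
  case 0
  have "continuous_on UNIV (\<lambda>x. f (L x))"
    using 0 assms(2) by (auto intro: continuous_on_compose2 simp: linear_continuous_on)
  then show ?case
    using bounded_linear.continuous_on[OF assms(1)] by (auto intro!: continuous_intros)
next
  case (Suc n)
  have D: "((\<lambda>x. T (f (L x)) + c) has_derivative (\<lambda>v. T (frechet_derivative f (at (L x)) (L v)))) (at x)" for x
  proof -
    have f: "(f has_derivative frechet_derivative f (at (L x))) (at (L x))"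
      using Suc.prems by (simp add: frechet_derivative_works[symmetric])
    have "((\<lambda>x. f (L x)) has_derivative (\<lambda>v. frechet_derivative f (at (L x)) (L v))) (at x)"
      using has_derivative_compose[OF bounded_linear_imp_has_derivative[OF assms(2)] f] .
    then show ?thesis
      using has_derivative_add_const bounded_linear.has_derivative[OF assms(1)] by blast
  qed
  have "frechet_derivative (\<lambda>x. T (f (L x)) + c) (at x) v = T (frechet_derivative f (at (L x)) (L v))" for x v
    using frechet_derivative_at[OF D] by metis
  moreover have "Ck n (\<lambda>x. T (frechet_derivative f (at (L x)) (L v)) + 0)" for v
    using Suc.prems by (intro Suc.IH) simp
  moreover have "(\<lambda>x. T (f (L x)) + c) differentiable (at x)" for x
    using D differentiable_def by blast
  ultimately show ?case by simp
qed

lemma gprod_g_psi: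
  "gprod (g_psi \<psi>) z u v =
     (\<Sum>i\<in>UNIV. \<Sum>j\<in>UNIV. u $ Inl i * \<psi> (xpart z) $ i $ j * v $ Inl j)
     + (\<Sum>i\<in>UNIV. u $ Inl i * v $ Inr i) + (\<Sum>i\<in>UNIV. u $ Inr i * v $ Inl i)"
proof -
  have S: "sum f (UNIV :: ('n::finite + 'n) set) = (\<Sum>i\<in>UNIV. f (Inl i)) + (\<Sum>i\<in>UNIV. f (Inr i))"
    for f :: "_ \<Rightarrow> real"
    unfolding UNIV_Plus_UNIV[symmetric] by (subst sum.Plus) auto
  show ?thesis
    by (simp add: gprod_def inner_vec_def matrix_vector_mult_def S g_psi_def sum_distrib_left
        distrib_left sum.distrib mult_ac if_distrib if_distribR cong: if_cong)
qed

theorem g_psi_pseudo_riemannian: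
  fixes \<psi> :: "real^'n::finite \<Rightarrow> real^'n^'n"
  assumes "smooth_sym2_tensor \<psi>"
  shows "pseudo_riemannian CARD('n) CARD('n) (g_psi \<psi>)"
proof -
  have sy: "\<psi> x $ i $ j = \<psi> x $ j $ i" for x i j
    using assms symmetric_nth[of "\<psi> x"] unfolding smooth_sym2_tensor_def by blast
  have sm: "smooth (g_psi \<psi>)"
  proof -
    define T :: "real^'n^'n \<Rightarrow> real^('n + 'n)^('n + 'n)" where
      "T A = (\<chi> a b. case (a, b) of (Inl i, Inl j) \<Rightarrow> A $ i $ j | _ \<Rightarrow> 0)" for A
    have "linear T"
      by (rule linearI) (auto simp: T_def vec_eq_iff split: sum.split)
    then have T: "bounded_linear T" by (rule linear_conv_bounded_linear[THEN iffD1])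
    have "linear (xpart :: real^('n + 'n) \<Rightarrow> real^'n)"
      by (rule linearI) (auto simp: xpart_def vec_eq_iff)
    then have L: "bounded_linear (xpart :: real^('n + 'n) \<Rightarrow> real^'n)"
      by (rule linear_conv_bounded_linear[THEN iffD1])
    have "g_psi \<psi> = (\<lambda>z. T (\<psi> (xpart z)) + g_psi (\<lambda>_. 0) 0)"
      by (auto simp: fun_eq_iff T_def g_psi_def vec_eq_iff split: sum.split)
    then show ?thesis
      using assms Ck_linear_comp[OF T L] unfolding smooth_sym2_tensor_def smooth_def by metis
  qed
  have tr: "transpose (g_psi \<psi> z) = g_psi \<psi> z" for z
    by (auto simp: transpose_def g_psi_def vec_eq_iff sy split: sum.split)
  have gr: "UNIV \<in> Gr (g_psi \<psi>) CARD('n) CARD('n) z" for z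
  proof -
    let ?g = "gprod (g_psi \<psi>) z"
    define e :: "real \<Rightarrow> 'n \<Rightarrow> real^('n + 'n)" where
      "e s i = (\<chi> a. case a of Inl j \<Rightarrow> (if j = i then 1 else 0)
          | Inr j \<Rightarrow> (if j = i then s / 2 else 0) - \<psi> (xpart z) $ i $ j / 2)" for s i
    have lin: "linear (\<lambda>u. ?g u v)" for v
      by (rule linearI) (simp_all add: gprod_def inner_add_left)
    have ee: "?g (e s i) (e t j) = (if i = j then (s + t) / 2 else 0)" for s t i j
    proof -
      have l: "e s i $ Inl a = (if a = i then 1 else 0)" for s i a by (simp add: e_def)
      have r: "e s i $ Inr a = (if a = i then s / 2 else 0) - \<psi> (xpart z) $ i $ a / 2" for s i a
        by (simp add: e_def)
      have d: "(if a = k then 1 else 0) * (c :: real) = (if a = k then c else 0)"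
          "c * (if a = k then 1 else 0) = (if a = k then c else 0)" for a k :: 'n and c
        by simp_all
      have "?g (e s i) (e t j) = \<psi> (xpart z) $ i $ j + e t j $ Inr i + e s i $ Inr j"
        unfolding gprod_g_psi l d by simp
      then show ?thesis by (auto simp: r sy[of _ j i] add_divide_distrib)
    qed
    define B where "B = range (e 1) \<union> range (e (-1))"
    have inj: "inj (e s)" for s
      unfolding inj_def e_def 
    proof (intro ballI allI impI)
      fix i j assume "(\<chi> a. case a of Inl j \<Rightarrow> (if j = i then 1 else 0)
          | Inr j \<Rightarrow> (if j = i then s / 2 else 0) - \<psi> (xpart z) $ i $ j / 2) =
        (\<chi> a. case a of Inl k \<Rightarrow> (if k = j then 1 else 0)
          | Inr k \<Rightarrow> (if k = j then s / 2 else 0) - \<psi> (xpart z) $ j $ k / 2)"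
        (is "?a = ?b")
      then have "?a $ Inl i = ?b $ Inl i" by (rule arg_cong)
      then show "i = j" by (simp split: if_splits)
    qed
    have norm: "\<forall>u\<in>B. ?g u u = 1 \<or> ?g u u = - 1" by (auto simp: B_def ee)
    have orth: "\<forall>u\<in>B. \<forall>v\<in>B. u \<noteq> v \<longrightarrow> ?g u v = 0"
      by (auto simp: B_def ee)
    have disj: "range (e 1) \<inter> range (e (-1)) = {}"
    proof -
      have "e 1 i \<noteq> e (-1) j" for i j
        using ee[of 1 i 1 i] ee[of "-1" j "-1" j] by auto
      then show ?thesis by auto
    qed
    have fin: "finite B" by (simp add: B_def)
    have ind: "independent B"
    proof (rule independent_if_scalars_zero[OF fin])
      fix f b assume s0: "(\<Sum>x\<in>B. f x *\<^sub>R x) = 0" and b: "b \<in> B"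
      have "0 = ?g (\<Sum>x\<in>B. f x *\<^sub>R x) b"
        using linear_0[OF lin] s0 by metis
      also have "\<dots> = (\<Sum>x\<in>B. f x * ?g x b)"
        by (simp add: linear_sum[OF lin] linear_cmul[OF lin])
      also have "\<dots> = (\<Sum>x\<in>B. if x = b then f b * ?g b b else 0)"
        using orth b by (intro sum.cong) auto
      also have "\<dots> = f b * ?g b b" using b fin by simp
      finally show "f b = 0" using norm b by fastforce
    qed
    have "card B = CARD('n) + CARD('n)"
      unfolding B_def by (subst card_Un_disjoint) (auto simp: disj card_image inj)
    then have "span B = UNIV"
      using card_eq_dim[of B UNIV] ind fin by (auto simp: dim_UNIV)
    moreover have "{u\<in>B. ?g u u < 0} = range (e (-1))" "{u\<in>B. ?g u u > 0} = range (e 1)"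
      by (auto simp: B_def ee)
    moreover have "nondegenerate_on (g_psi \<psi>) z UNIV"
      unfolding nondegenerate_on_def
    proof (intro ballI impI)
      fix u assume "\<forall>v\<in>UNIV. ?g u v = 0"
      then have 0: "?g u v = 0" for v by simp
      have "u $ Inl i = 0" for i
        using 0[of "axis (Inr i) 1"] unfolding gprod_g_psi
        by (simp add: axis_def if_distrib if_distribR cong: if_cong)
      moreover have "u $ Inr i = 0" for i
        using 0[of "axis (Inl i) 1"] calculation unfolding gprod_g_psi
        by (simp add: axis_def if_distrib if_distribR cong: if_cong)
      ultimately show "u = 0" by (auto simp: vec_eq_iff) (metis sum.exhaust)
    qed
    ultimately show ?thesis
      unfolding Gr_def orthonormal_basis_def using ind norm orth
      by (auto intro!: exI[of _ B] simp: card_image inj)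
  qed
  show ?thesis
    unfolding pseudo_riemannian_def using sm tr gr by blast
qed

end

theory Submission
  imports Defs
begin

text \<open>
  The curvature tensor of \<open>g\<^sub>\<psi>\<close> only sees the \<open>x\<close>-parts of its arguments and takes its values in the
  \<open>y\<close>-directions (\<open>curv_at_g_psi\<close>), because the Christoffel symbols do. Hence every operator \<open>J(\<pi>)\<close>
  has a single nonzero block \<open>C\<close>, which maps \<open>x\<close>-parts to \<open>y\<close>-parts. Such an operator is nilpotent, so
  its eigenvalues are constant (\<open>osserman_g_psi\<close>), and its conjugacy class is determined by the rank of
  \<open>C\<close> (\<open>conjugate_lower_block_iff\<close>). The part of the theorem about Jordan forms is a matter of ranks.

  For \<open>\<psi> \<in> \<Psi>\<close> and \<open>a \<noteq> 0\<close> the block of \<open>J(a)\<close> is symmetric and positive semi-definite with kernel the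
  line of \<open>a\<close>. On a definite subspace \<open>\<pi>\<close> of dimension \<open>r\<close> the \<open>x\<close>-parts of an orthonormal basis are
  independent, since the \<open>y\<close>-directions are isotropic, and all terms of \<open>J(\<pi>)\<close> have the same sign. Its
  rank is therefore \<open>p - 1\<close> for \<open>r = 1\<close>, and \<open>p\<close> for \<open>r \<ge> 2\<close> (\<open>definite_signed_jac_rank\<close>). The types
  \<open>(p, p - r)\<close> and \<open>(p - r, p)\<close> are the orthogonal complements of definite subspaces; \<open>J(\<pi>)\<close> changes
  only its sign under passing to the complement, because \<open>g\<^sub>\<psi>\<close> is Ricci flat (\<open>jacobi_sub_rank\<close>).

  In mixed signature \<open>0 < r, s < p\<close> two subspaces with different ranks are exhibited. Spacelike and
  timelike unit vectors with the same \<open>x\<close>-part cancel. For \<open>r = s\<close> one can cancel everything, or all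
  but a nonzero difference of two operators. For \<open>r \<noteq> s\<close> one can cancel all but one vector of the
  rarer sign. What remains is, up to sign, a pencil \<open>A - \<mu> Q\<close> with \<open>A\<close> positive definite and \<open>Q\<close>
  positive semi-definite, where \<open>\<mu> > 0\<close> is free: it is singular at the reciprocal of
  the largest value of \<open>(Qv,v)/(Av,v)\<close>, and regular at half of that (\<open>definite_pencil\<close>).
\<close>

section \<open>Linear operators of equal rank\<close>

text \<open>The set \<open>U\<close> lifts a basis of the range. Every vector differs from the span of \<open>U\<close> by a
  vector of the kernel, so that kernel vectors are enough to complete \<open>U\<close> to a basis.\<close>

lemma linear_adapted_basis:
  fixes C :: "'a::euclidean_space \<Rightarrow> 'b::euclidean_space"
  assumes C: "linear C"
  obtains K U where "independent (K \<union> U)" "span (K \<union> U) = UNIV" "K \<inter> U = {}"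
    "\<And>k. k \<in> K \<Longrightarrow> C k = 0" "inj_on C U" "independent (C ` U)" "card U = dim (range C)"
proof -
  obtain R where R: "R \<subseteq> range C" "independent R" "range C \<subseteq> span R" "card R = dim (range C)"
    using basis_exists[of "range C"] by metis
  define s where "s r = (SOME x. C x = r)" for r
  have s: "C (s r) = r" if "r \<in> R" for r
    unfolding s_def using R(1) that by (auto intro: someI)
  define U where "U = s ` R"
  have CU: "C ` U = R" by (force simp: U_def s)
  have inj: "inj_on C U" by (auto simp: U_def inj_on_def s)
  have indU: "independent U"
  proof
    assume "dependent U"
    then obtain u where u: "u \<in> U" "u \<in> span (U - {u})" unfolding dependent_def by blast
    have "C u \<in> span (C ` (U - {u}))" using u(2) linear_span_image[OF C] by blast
    also have "C ` (U - {u}) = R - {C u}" using inj u(1) CU by (auto simp: inj_on_def)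
    finally show False using R(2) u(1) CU unfolding dependent_def by blast
  qed
  obtain B where B: "U \<subseteq> B" "B \<subseteq> U \<union> {x. C x = 0}" "independent B" "U \<union> {x. C x = 0} \<subseteq> span B"
    using maximal_independent_subset_extend[of U "U \<union> {x. C x = 0}"] indU by blast
  have "x \<in> span B" for x
  proof -
    have "C x \<in> span (C ` U)" using R(3) CU by blast
    then obtain u where u: "u \<in> span U" "C u = C x" using linear_span_image[OF C] by force
    have "C (x - u) = 0" using u(2) by (simp add: linear_diff[OF C])
    then have "x - u \<in> span B" using B(4) by blast
    moreover have "u \<in> span B" using u(1) span_mono[OF B(1)] by blast
    ultimately show ?thesis using span_add[of "x - u" B u] by simp
  qed
  moreover have "(B - U) \<union> U = B" using B(1) by blast
  moreover have "card U = dim (range C)"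
    using card_image[OF inj] CU R(4) by simp
  ultimately show ?thesis
    using that[of "B - U" U] B inj CU R(2) by auto
qed

text \<open>Adapted bases of the two operators are matched, kernel with kernel and complement with
  complement; this prescribes \<open>P\<close>, and \<open>Q\<close> on the range of \<open>C\<close>, by injective assignments of
  independent vectors.\<close>

lemma equal_rank_equivalent:
  fixes C C' :: "'a::euclidean_space \<Rightarrow> 'a"
  assumes C: "linear C" "linear C'" and rk: "dim (range C) = dim (range C')"
  obtains P Q where "linear P" "linear Q" "bij P" "bij Q" "\<And>x. Q (C x) = C' (P x)"
proof -
  obtain K U where B: "independent (K \<union> U)" "span (K \<union> U) = UNIV" "K \<inter> U = {}"
    "\<And>k. k \<in> K \<Longrightarrow> C k = 0" "inj_on C U" "independent (C ` U)" "card U = dim (range C)"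
    using linear_adapted_basis[OF C(1)] by blast
  obtain K' U' where B': "independent (K' \<union> U')" "span (K' \<union> U') = UNIV" "K' \<inter> U' = {}"
    "\<And>k. k \<in> K' \<Longrightarrow> C' k = 0" "inj_on C' U'" "independent (C' ` U')" "card U' = dim (range C')"
    using linear_adapted_basis[OF C(2)] by blast
  have fin: "finite (K \<union> U)" "finite (K' \<union> U')"
    using B(1) B'(1) independent_imp_finite by blast+
  have "card (K \<union> U) = card (K' \<union> U')"
    using B(1,2) B'(1,2) dim_eq_card by metis
  then have cK: "card K = card K'"
    using fin B(3,7) B'(3,7) rk by (simp add: card_Un_disjoint)
  obtain f where f: "bij_betw f U U'"
    using fin rk B(7) B'(7) finite_same_card_bij[of U U'] by auto
  obtain h where h: "bij_betw h K K'"
    using fin cK finite_same_card_bij[of K K'] by auto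
  define pf where "pf x = (if x \<in> U then f x else h x)" for x
  have pfU: "pf x = f x" if "x \<in> U" for x using that by (simp add: pf_def)
  have pfK: "pf x = h x" if "x \<in> K" for x using that B(3) by (auto simp: pf_def)
  have bU: "bij_betw pf U U'" using f by (rule bij_betw_cong[THEN iffD1, rotated]) (simp add: pfU)
  have bK: "bij_betw pf K K'" using h by (rule bij_betw_cong[THEN iffD1, rotated]) (simp add: pfK)
  have bij: "bij_betw pf (K \<union> U) (K' \<union> U')"
    using bij_betw_combine[OF bK bU B'(3)] .
  obtain P where P: "linear P" "inj P" "\<forall>x\<in>K \<union> U. P x = pf x"
    using linear_independent_extend_inj[OF B(1), of pf] bij B'(1) unfolding bij_betw_def by auto
  define qf where "qf y = C' (f (the_inv_into U C y))" for y
  have qf: "qf (C u) = C' (f u)" if "u \<in> U" for u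
    using that by (simp add: qf_def the_inv_into_f_f[OF B(5)])
  have "qf ` (C ` U) = C' ` (f ` U)" by (auto simp: image_image qf)
  also have "\<dots> = C' ` U'" using f by (simp add: bij_betw_def)
  finally have qi: "qf ` (C ` U) = C' ` U'" .
  have "inj_on qf (C ` U)"
  proof (rule inj_onI; clarify)
    fix u v assume uv: "u \<in> U" "v \<in> U" "qf (C u) = qf (C v)"
    then have "f u = f v" using B'(5) f by (auto simp: qf bij_betw_def inj_on_def)
    then show "C u = C v" using f uv by (auto simp: bij_betw_def inj_on_def)
  qed
  then obtain Q where Q: "linear Q" "inj Q" "\<forall>x\<in>C ` U. Q x = qf x"
    using linear_independent_extend_inj[OF B(6), of qf] qi B'(6) by auto
  have "(Q \<circ> C) x = (C' \<circ> P) x" for x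
  proof (rule linear_eq_on_span[of "Q \<circ> C" "C' \<circ> P" "K \<union> U"])
    show "linear (Q \<circ> C)" "linear (C' \<circ> P)" using C P(1) Q(1) by (auto intro: linear_compose)
    show "x \<in> span (K \<union> U)" using B(2) by simp
    fix b assume b: "b \<in> K \<union> U"
    show "(Q \<circ> C) b = (C' \<circ> P) b"
    proof (cases "b \<in> U")
      case True
      then show ?thesis using P(3) Q(3) qf pfU by simp
    next
      case False
      then have "b \<in> K" using b by blast
      moreover from this have "C' (h b) = 0" using h B'(4) by (auto simp: bij_betw_def)
      ultimately show ?thesis using P(3) B(4) pfK linear_0[OF Q(1)] by simp
    qed
  qed
  then show ?thesis
    using that[OF P(1) Q(1)] P Q by (simp add: bij_def linear_injective_imp_surjective)
qed

lemma dim_range_full_iff: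
  fixes C :: "'a::euclidean_space \<Rightarrow> 'a"
  assumes C: "linear C"
  shows "dim (range C) = DIM('a) \<longleftrightarrow> (\<forall>x. C x = 0 \<longrightarrow> x = 0)"
proof -
  have "dim (range C) = DIM('a) \<longleftrightarrow> surj C"
    using dim_eq_full[of "range C"] span_eq_iff[of "range C"] linear_subspace_image[OF C subspace_UNIV] 
    by metis
  also have "\<dots> \<longleftrightarrow> inj C"
    using C linear_injective_imp_surjective linear_surjective_imp_injective by blast
  finally show ?thesis using linear_injective_0[OF C] by blast
qed

section \<open>Strictly block-triangular operators\<close>

definition xy :: "real^'n \<Rightarrow> real^'n \<Rightarrow> real^('n::finite + 'n)" where
  "xy x y = (\<chi> a. case a of Inl i \<Rightarrow> x $ i | Inr i \<Rightarrow> y $ i)"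

definition ypart :: "real^('n::finite + 'n) \<Rightarrow> real^'n" where
  "ypart z = (\<chi> i. z $ Inr i)"

lemma xy_nth [simp]: "xy x y $ Inl i = x $ i" "xy x y $ Inr i = y $ i"
  by (simp_all add: xy_def)

lemma xpart_nth [simp]: "xpart z $ i = z $ Inl i" and ypart_nth [simp]: "ypart z $ i = z $ Inr i"
  by (simp_all add: xpart_def ypart_def)

lemma vec_plus_eqI:
  fixes u v :: "'a^('n::finite + 'n)"
  assumes "\<And>i. u $ Inl i = v $ Inl i" "\<And>i. u $ Inr i = v $ Inr i"
  shows "u = v"
  unfolding vec_eq_iff using assms by (metis sum.exhaust)

lemma xpart_xy [simp]: "xpart (xy x y) = x" and ypart_xy [simp]: "ypart (xy x y) = y"
  by (simp_all add: vec_eq_iff)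

lemma xy_parts [simp]: "xy (xpart z) (ypart z) = z"
  by (rule vec_plus_eqI) simp_all

lemma xy_arith:
  "xy x y + xy x' y' = xy (x + x') (y + y')" "xy x y - xy x' y' = xy (x - x') (y - y')"
  "c *\<^sub>R xy x y = xy (c *\<^sub>R x) (c *\<^sub>R y)" "- xy x y = xy (- x) (- y)"
  by (rule vec_plus_eqI; simp)+

lemma xy_0 [simp]: "xy 0 0 = 0"
  by (rule vec_plus_eqI) simp_all

lemma xy_eq_iff [simp]: "xy x y = xy x' y' \<longleftrightarrow> x = x' \<and> y = y'"
  by (metis xpart_xy ypart_xy)

lemma surj_xpart: "range xpart = UNIV"
  by (rule surjI[of _ "\<lambda>x. xy x 0"]) simp

lemma linear_xpart: "linear xpart" and linear_ypart: "linear ypart"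
  by (rule linearI; simp add: vec_eq_iff)+

lemma linear_xy0: "linear (xy 0)"
  by (rule linearI; simp add: xy_arith)

lemma xpart_arith [simp]: "xpart (u + v) = xpart u + xpart v" "xpart (u - v) = xpart u - xpart v"
  "xpart (c *\<^sub>R u) = c *\<^sub>R xpart u" "xpart (- u) = - xpart u" "xpart 0 = 0"
  by (simp_all add: vec_eq_iff)

definition lower_block :: "(real^'n \<Rightarrow> real^'n) \<Rightarrow> real^('n::finite + 'n) \<Rightarrow> real^('n + 'n)" where
  "lower_block C z = xy 0 (C (xpart z))"

lemma dim_range_lower_block:
  fixes C :: "real^'n::finite \<Rightarrow> real^'n"
  assumes "linear C"
  shows "dim (range (lower_block C)) = dim (range C)"
proof -
  have "range (lower_block C) = (\<lambda>x. xy 0 (C x)) ` range xpart"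
    unfolding image_image lower_block_def ..
  then have "range (lower_block C) = xy 0 ` range C"
    unfolding surj_xpart by (simp add: image_image)
  moreover have "inj_on (xy 0) (span (range C))" by (simp add: inj_on_def)
  ultimately show ?thesis using dim_image_eq[OF linear_xy0] by simp
qed

lemma conjugate_dim_range:
  fixes A B :: "real^'m::finite \<Rightarrow> real^'m"
  assumes "conjugate A B"
  shows "dim (range A) = dim (range B)"
proof -
  obtain T where T: "linear T" "bij T" "T \<circ> A = B \<circ> T"
    using assms unfolding conjugate_def by blast
  have "T ` range A = B ` range T"
    unfolding image_comp T(3) ..
  then have TA: "T ` range A = range B" using T(2) by (simp add: bij_def)
  have "inj_on T (span (range A))"
    using T(2) by (auto simp: bij_def intro: inj_on_subset)
  from dim_image_eq[OF T(1) this] show ?thesis unfolding TA by simp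
qed

text \<open>An equivalence of \<open>C\<close> with \<open>C'\<close>, with \<open>P\<close> acting on the \<open>x\<close>- and \<open>Q\<close> on the \<open>y\<close>-coordinates,
  is a conjugation of the block operators. Rank is therefore the only invariant, and every
  question about Jordan forms below becomes a question about ranks.\<close>

lemma conjugate_lower_block_iff:
  fixes C C' :: "real^'n::finite \<Rightarrow> real^'n"
  assumes C: "linear C" "linear C'"
  shows "conjugate (lower_block C) (lower_block C') \<longleftrightarrow> dim (range C) = dim (range C')"
proof
  assume "conjugate (lower_block C) (lower_block C')"
  from conjugate_dim_range[OF this] show "dim (range C) = dim (range C')"
    by (simp add: dim_range_lower_block C)
next
  assume "dim (range C) = dim (range C')"
  then obtain P Q where PQ: "linear P" "linear Q" "bij P" "bij Q" "\<And>x. Q (C x) = C' (P x)"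
    using equal_rank_equivalent[OF C] by blast
  define T where "T z = xy (P (xpart z)) (Q (ypart z))" for z
  have linT: "linear T"
    unfolding T_def
    by (rule linearI) (simp_all add: xy_arith linear_add[OF linear_ypart] linear_cmul[OF linear_ypart]
        linear_add[OF PQ(1)] linear_add[OF PQ(2)] linear_cmul[OF PQ(1)] linear_cmul[OF PQ(2)])
  have "inj T"
  proof (rule injI)
    fix u v assume "T u = T v"
    then have "xpart u = xpart v" "ypart u = ypart v"
      using PQ(3,4) by (simp_all add: T_def bij_def inj_eq)
    then show "u = v" using xy_parts by metis
  qed
  then have "bij T"
    using linear_injective_imp_surjective[OF linT] by (simp add: bij_def)
  moreover have "T (lower_block C z) = lower_block C' (T z)" for z
    using linear_0[OF PQ(1)] PQ(5) by (simp add: T_def lower_block_def)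
  ultimately show "conjugate (lower_block C) (lower_block C')"
    unfolding conjugate_def using linT by (intro exI[of _ T]) (simp add: fun_eq_iff)
qed

text \<open>In the determinant of \<open>t - lower_block C\<close> a row \<open>Inl i\<close> only meets the column \<open>Inl i\<close>, and then
  a row \<open>Inr i\<close> only the column \<open>Inr i\<close>: the identity is the only permutation that contributes.\<close>

lemma charpoly_lower_block:
  fixes C :: "real^'n::finite \<Rightarrow> real^'n"
  assumes C: "linear C"
  shows "charpoly (lower_block C) = [:0, 1:] ^ CARD('n + 'n)"
proof -
  define M :: "complex poly^('n + 'n)^('n + 'n)" where
    "M = mat [:0, 1:] - (\<chi> i j. [:complex_of_real (matrix (lower_block C) $ i $ j):])"
  have Minl: "M $ Inl i $ b = (if b = Inl i then [:0, 1:] else 0)" for i b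
    by (simp add: M_def mat_def matrix_def lower_block_def)
  have "xpart (axis (Inr i) 1 :: real^('n + 'n)) = 0" for i
    by (simp add: vec_eq_iff axis_def)
  then have Minr: "M $ Inr i $ Inr j = (if i = j then [:0, 1:] else 0)" for i j
    by (simp add: M_def mat_def matrix_def lower_block_def linear_0[OF C])
  define t where "t \<sigma> = of_int (sign \<sigma>) * (\<Prod>a\<in>UNIV. M $ a $ \<sigma> a)" for \<sigma>
  have t0: "t \<sigma> = 0" if \<sigma>: "\<sigma> permutes UNIV" "\<sigma> \<noteq> id" for \<sigma>
  proof -
    have "\<exists>a. M $ a $ \<sigma> a = 0"
    proof (rule ccontr)
      assume "\<not> ?thesis"
      then have nz: "M $ a $ \<sigma> a \<noteq> 0" for a by blast
      have l: "\<sigma> (Inl i) = Inl i" for i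
        using nz[of "Inl i"] Minl by metis
      have r: "\<sigma> (Inr i) = Inr i" for i
      proof (cases "\<sigma> (Inr i)")
        case (Inl j)
        then have "Inr i = Inl j" using l[of j] permutes_inj[OF \<sigma>(1)] by (metis injD)
        then show ?thesis by simp
      next
        case (Inr j)
        then show ?thesis using nz[of "Inr i"] Minr by metis
      qed
      have "\<sigma> a = a" for a by (cases a) (simp_all add: l r)
      then show False using \<sigma>(2) by auto
    qed
    then have "(\<Prod>a\<in>UNIV. M $ a $ \<sigma> a) = 0" by (metis UNIV_I finite prod_zero)
    then show ?thesis by (simp add: t_def)
  qed
  have "M $ a $ a = [:0, 1:]" for a by (cases a) (simp_all add: Minl Minr)
  then have tid: "t id = [:0, 1:] ^ CARD('n + 'n)" by (simp add: t_def)
  have "charpoly (lower_block C) = sum t {\<sigma>. \<sigma> permutes UNIV}"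
    unfolding charpoly_def det_def t_def M_def ..
  also have "\<dots> = sum t {id}"
    by (rule sum.mono_neutral_right) (auto simp: finite_permutations permutes_id t0)
  finally show ?thesis using tid by simp
qed

section \<open>Pseudo-orthonormal bases\<close>

lemma gprod_commute:
  assumes "transpose (g x) = g x"
  shows "gprod g x u v = gprod g x v u"
  unfolding gprod_def using dot_lmul_matrix[of u "g x" v] transpose_matrix_vector[of "g x" u] assms
  by (simp add: inner_commute)

lemma bilinear_gprod: "bilinear (gprod g x)"
  unfolding bilinear_def
  by (auto intro!: linearI simp: gprod_def inner_add_left inner_add_right matrix_vector_right_distrib
      matrix_vector_mult_scaleR)

lemmas gprod_simps = bilinear_ladd[OF bilinear_gprod] bilinear_radd[OF bilinear_gprod]
  bilinear_lsub[OF bilinear_gprod] bilinear_rsub[OF bilinear_gprod]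
  bilinear_lmul[OF bilinear_gprod] bilinear_rmul[OF bilinear_gprod]
  bilinear_lzero[OF bilinear_gprod] bilinear_rzero[OF bilinear_gprod]

lemma gprod_sum_left: "gprod g x (\<Sum>e\<in>S. c e *\<^sub>R e) v = (\<Sum>e\<in>S. c e * gprod g x e v)"
  by (induction S rule: infinite_finite_induct) (simp_all add: gprod_simps)

text \<open>No span is prescribed, so that a basis can be split into subsets, or built up vector by vector.\<close>

definition orthonormal_set :: "'m::finite metric \<Rightarrow> real^'m \<Rightarrow> (real^'m) set \<Rightarrow> bool" where
  "orthonormal_set g x B \<longleftrightarrow> finite B \<and> (\<forall>u\<in>B. gprod g x u u = 1 \<or> gprod g x u u = - 1) \<and>
     (\<forall>u\<in>B. \<forall>v\<in>B. u \<noteq> v \<longrightarrow> gprod g x u v = 0)"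

lemma gprod_orthonormal_sum:
  assumes "orthonormal_set g x B" and "b \<in> B"
  shows "gprod g x (\<Sum>e\<in>B. c e *\<^sub>R e) b = c b * gprod g x b b"
proof -
  have "gprod g x (\<Sum>e\<in>B. c e *\<^sub>R e) b = (\<Sum>e\<in>B. if e = b then c b * gprod g x b b else 0)"
    unfolding gprod_sum_left using assms by (intro sum.cong) (auto simp: orthonormal_set_def)
  then show ?thesis using assms by (simp add: orthonormal_set_def)
qed

lemma orthonormal_set_independent:
  assumes B: "orthonormal_set g x B"
  shows "independent B"
proof (rule independent_if_scalars_zero)
  show "finite B" using B by (simp add: orthonormal_set_def)
  fix f b assume "(\<Sum>e\<in>B. f e *\<^sub>R e) = 0" "b \<in> B"
  then show "f b = 0"
    using gprod_orthonormal_sum[OF B, of b f] B by (auto simp: orthonormal_set_def gprod_simps)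
qed

lemma orthonormal_basis_iff: "orthonormal_basis g x V B \<longleftrightarrow> orthonormal_set g x B \<and> span B = V"
  using orthonormal_set_independent independent_imp_finite
  unfolding orthonormal_basis_def orthonormal_set_def by blast

lemma orthonormal_set_subset: "orthonormal_set g x B \<Longrightarrow> T \<subseteq> B \<Longrightarrow> orthonormal_set g x T"
  unfolding orthonormal_set_def using finite_subset by blast

lemma orthonormal_expansion:
  assumes B: "orthonormal_set g x B" and v: "v \<in> span B"
  shows "v = (\<Sum>e\<in>B. (gprod g x e e * gprod g x v e) *\<^sub>R e)"
proof -
  have "finite B" using B by (simp add: orthonormal_set_def)
  then obtain c where c: "v = (\<Sum>e\<in>B. c e *\<^sub>R e)"
    using v span_finite[of B] by auto
  have "gprod g x e e * gprod g x v e = c e" if "e \<in> B" for e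
    using gprod_orthonormal_sum[OF B that, of c] B that by (auto simp: c orthonormal_set_def)
  then show ?thesis by (simp add: c)
qed

lemma gprod_orthonormal_square:
  assumes sym: "transpose (g x) = g x" and B: "orthonormal_set g x B" and v: "v \<in> span B"
  shows "gprod g x v v = (\<Sum>e\<in>B. gprod g x e e * (gprod g x v e)\<^sup>2)" (is "_ = ?R")
    and "v \<noteq> 0 \<Longrightarrow> \<exists>e\<in>B. gprod g x v e \<noteq> 0"
proof -
  define w where "w = (\<Sum>e\<in>B. (gprod g x e e * gprod g x v e) *\<^sub>R e)"
  have wv: "w = v" using orthonormal_expansion[OF B v] by (simp add: w_def)
  have "gprod g x w v = (\<Sum>e\<in>B. (gprod g x e e * gprod g x v e) * gprod g x e v)"
    unfolding w_def by (rule gprod_sum_left)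
  also have "\<dots> = ?R"
  proof (rule sum.cong[OF refl])
    fix e assume "e \<in> B"
    have "gprod g x e v = gprod g x v e"
      by (rule gprod_commute[where g = g and x = x, OF sym])
    then show "gprod g x e e * gprod g x v e * gprod g x e v = gprod g x e e * (gprod g x v e)\<^sup>2"
      by (simp add: power2_eq_square)
  qed
  finally show "gprod g x v v = ?R" unfolding wv .
  assume "v \<noteq> 0"
  then show "\<exists>e\<in>B. gprod g x v e \<noteq> 0"
    using wv unfolding w_def by (metis (no_types, lifting) mult_zero_right scaleR_zero_left sum.neutral)
qed

text \<open>For an orthonormal basis \<open>B\<close> of \<open>V\<close> the tensor \<open>\<Sum>e\<in>B. (e,e) e \<otimes> e\<close> is the inverse of the
  metric of \<open>V\<close>; expanding one basis in the other shows that it does not depend on \<open>B\<close>.\<close>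

lemma orthonormal_trace_independent:
  fixes \<beta> :: "real^'m::finite \<Rightarrow> real^'m \<Rightarrow> 'c::real_vector"
  assumes sym: "transpose (g x) = g x" and \<beta>: "bilinear \<beta>"
    and B: "orthonormal_basis g x V B" and B': "orthonormal_basis g x V B'"
  shows "(\<Sum>e\<in>B. gprod g x e e *\<^sub>R \<beta> e e) = (\<Sum>e\<in>B'. gprod g x e e *\<^sub>R \<beta> e e)"
proof -
  have o: "orthonormal_set g x B" "orthonormal_set g x B'" and sp: "span B = V" "span B' = V"
    using B B' by (simp_all add: orthonormal_basis_iff)
  have r: "\<beta> u (\<Sum>f\<in>S. c f *\<^sub>R f) = (\<Sum>f\<in>S. c f *\<^sub>R \<beta> u f)" for u c S
    using \<beta> unfolding bilinear_def by (simp add: linear_sum linear_cmul)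
  have l: "\<beta> (\<Sum>f\<in>S. c f *\<^sub>R f) u = (\<Sum>f\<in>S. c f *\<^sub>R \<beta> f u)" for u c S
    using \<beta> unfolding bilinear_def by (simp add: linear_sum[of "\<lambda>v. \<beta> v u"] linear_cmul[of "\<lambda>v. \<beta> v u"])
  have cm: "gprod g x f e = gprod g x e f" for e f
    by (rule gprod_commute[where g = g and x = x, OF sym])
  have "(\<Sum>e\<in>B. gprod g x e e *\<^sub>R \<beta> e e)
      = (\<Sum>e\<in>B. \<Sum>f\<in>B'. (gprod g x e e * gprod g x f f * gprod g x e f) *\<^sub>R \<beta> e f)"
  proof (rule sum.cong[OF refl])
    fix e assume "e \<in> B"
    then have "e \<in> span B'" using sp span_base by blast
    from arg_cong[where f = "\<beta> e", OF orthonormal_expansion[OF o(2) this]]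
    have "\<beta> e e = (\<Sum>f\<in>B'. (gprod g x f f * gprod g x e f) *\<^sub>R \<beta> e f)" by (simp only: r)
    then show "gprod g x e e *\<^sub>R \<beta> e e
        = (\<Sum>f\<in>B'. (gprod g x e e * gprod g x f f * gprod g x e f) *\<^sub>R \<beta> e f)"
      by (simp add: scaleR_sum_right mult_ac)
  qed
  also have "\<dots> = (\<Sum>f\<in>B'. \<Sum>e\<in>B. (gprod g x e e * gprod g x f f * gprod g x e f) *\<^sub>R \<beta> e f)"
    by (rule sum.swap)
  also have "\<dots> = (\<Sum>f\<in>B'. gprod g x f f *\<^sub>R \<beta> f f)"
  proof (rule sum.cong[OF refl])
    fix f assume "f \<in> B'"
    then have "f \<in> span B" using sp span_base by blast
    from orthonormal_expansion[OF o(1) this]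
    have "f = (\<Sum>e\<in>B. (gprod g x e e * gprod g x e f) *\<^sub>R e)" by (simp only: cm[of f])
    from arg_cong[where f = "\<lambda>w. \<beta> w f", OF this]
    have "\<beta> f f = (\<Sum>e\<in>B. (gprod g x e e * gprod g x e f) *\<^sub>R \<beta> e f)" by (simp only: l)
    then show "(\<Sum>e\<in>B. (gprod g x e e * gprod g x f f * gprod g x e f) *\<^sub>R \<beta> e f) = gprod g x f f *\<^sub>R \<beta> f f"
      by (simp add: scaleR_sum_right mult_ac)
  qed
  finally show ?thesis .
qed

lemma orthonormal_set_insert:
  assumes sym: "transpose (g x) = g x" and B: "orthonormal_set g x B"
    and t: "gprod g x t t \<noteq> 0" "\<And>e. e \<in> B \<Longrightarrow> gprod g x t e = 0"
  obtains u where "u \<notin> B" "orthonormal_set g x (insert u B)"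
proof -
  define u where "u = (1 / sqrt \<bar>gprod g x t t\<bar>) *\<^sub>R t"
  have "gprod g x u u = gprod g x t t / \<bar>gprod g x t t\<bar>"
    using t(1) by (simp add: u_def gprod_simps)
  then have uu: "gprod g x u u = 1 \<or> gprod g x u u = - 1"
    using t(1) by (auto simp: abs_if)
  have ue: "gprod g x u e = 0" "gprod g x e u = 0" if "e \<in> B" for e
    using t(2)[OF that] gprod_commute[where g = g and x = x, OF sym, of e t] by (simp_all add: u_def gprod_simps)
  have "u \<notin> B" using uu ue by fastforce
  moreover have "orthonormal_set g x (insert u B)"
    using B uu ue unfolding orthonormal_set_def by auto
  ultimately show ?thesis using that by blast
qed

text \<open>If the orthogonal complement of \<open>B\<close> is nonzero then, the metric being nondegenerate, it
  contains \<open>w\<close> and \<open>u\<close> with \<open>(w,u) \<noteq> 0\<close>, and by polarization one of \<open>w\<close>, \<open>u\<close>, \<open>w + u\<close> is not null.\<close>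

lemma orthonormal_extend:
  assumes sym: "transpose (g x) = g x" and nd: "nondegenerate_on g x UNIV"
    and B: "orthonormal_set g x B"
  obtains C where "B \<subseteq> C" "orthonormal_basis g x UNIV C"
proof -
  have "\<exists>C. B \<subseteq> C \<and> orthonormal_basis g x UNIV C" if "orthonormal_set g x B" for B :: "(real^'a) set"
    using that
  proof (induction "CARD('a) - card B" arbitrary: B rule: less_induct)
    case (less B)
    note B = less.prems
    have fin: "finite B" using B by (simp add: orthonormal_set_def)
    show ?case
    proof (cases "span B = UNIV")
      case True
      then show ?thesis using B by (auto simp: orthonormal_basis_iff)
    next
      case False
      define pr where "pr v = v - (\<Sum>e\<in>B. (gprod g x e e * gprod g x v e) *\<^sub>R e)" for v
      have pr0: "gprod g x (pr v) e = 0" if "e \<in> B" for v e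
        using gprod_orthonormal_sum[OF B that] B that
        by (auto simp: pr_def gprod_simps orthonormal_set_def)
      obtain v where v: "v \<notin> span B" using False by blast
      define w where "w = pr v"
      have "(\<Sum>e\<in>B. (gprod g x e e * gprod g x v e) *\<^sub>R e) \<in> span B"
        by (intro span_sum span_scale span_base)
      then have "w \<noteq> 0" using v by (auto simp: w_def pr_def)
      then obtain u where u: "gprod g x w u \<noteq> 0"
        using nd unfolding nondegenerate_on_def by blast
      have "gprod g x e w = 0" if "e \<in> B" for e
        using pr0[OF that, of v] gprod_commute[where g = g and x = x, OF sym, of e w] by (simp add: w_def)
      then have "gprod g x (\<Sum>e\<in>B. c e *\<^sub>R e) w = 0" for c
        unfolding gprod_sum_left by simp
      then have "gprod g x w (\<Sum>e\<in>B. c e *\<^sub>R e) = 0" for c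
        using gprod_commute[where g = g and x = x, OF sym, of w] by simp
      then have wu: "gprod g x w (pr u) \<noteq> 0" using u by (simp add: pr_def gprod_simps)
      have "\<exists>t. gprod g x t t \<noteq> 0 \<and> (\<forall>e\<in>B. gprod g x t e = 0)"
      proof (cases "gprod g x w w = 0 \<and> gprod g x (pr u) (pr u) = 0")
        case True
        then have "gprod g x (w + pr u) (w + pr u) \<noteq> 0"
          using wu gprod_commute[where g = g and x = x, OF sym, of "pr u" w] by (simp add: gprod_simps)
        then show ?thesis
          using pr0 by (intro exI[of _ "w + pr u"]) (simp add: gprod_simps w_def)
      next
        case False
        then consider "gprod g x w w \<noteq> 0" | "gprod g x (pr u) (pr u) \<noteq> 0" by blast
        then show ?thesis
          by cases (use pr0 in \<open>auto simp: w_def\<close>)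
      qed
      then obtain t' where t': "gprod g x t' t' \<noteq> 0" "\<And>e. e \<in> B \<Longrightarrow> gprod g x t' e = 0" by blast
      obtain t where t: "t \<notin> B" "orthonormal_set g x (insert t B)"
        using orthonormal_set_insert[OF sym B t'] .
      have "card (insert t B) \<le> CARD('a)"
        using independent_card_le_dim[OF _ orthonormal_set_independent[OF t(2)], of UNIV]
        by (simp add: dim_UNIV)
      then have "CARD('a) - card (insert t B) < CARD('a) - card B" using fin t(1) by simp
      from less.hyps[OF this t(2)] show ?thesis by blast
    qed
  qed
  from this[OF B] show ?thesis using that by blast
qed

text \<open>The span of the negative vectors of \<open>B\<close> meets the span of the positive vectors of \<open>B'\<close> only in
  \<open>0\<close>, so that their numbers add up to at most \<open>dim V\<close>.\<close>

lemma orthonormal_inertia_le: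
  assumes sym: "transpose (g x) = g x"
    and B: "orthonormal_basis g x V B" and B': "orthonormal_basis g x V B'"
  shows "card {e\<in>B. gprod g x e e < 0} \<le> card {e\<in>B'. gprod g x e e < 0}"
proof -
  define N where "N = {e\<in>B. gprod g x e e < 0}"
  define N' P' where "N' = {e\<in>B'. gprod g x e e < 0}" and "P' = {e\<in>B'. gprod g x e e > 0}"
  have o: "orthonormal_set g x B" "orthonormal_set g x B'" and sp: "span B = V" "span B' = V"
    using B B' by (simp_all add: orthonormal_basis_iff)
  have oN: "orthonormal_set g x N" and oP: "orthonormal_set g x P'"
    using orthonormal_set_subset[OF o(1)] orthonormal_set_subset[OF o(2)] by (auto simp: N_def P'_def)
  have "span N \<inter> span P' \<subseteq> {0}"
  proof
    fix v assume v: "v \<in> span N \<inter> span P'"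
    have "gprod g x v v \<ge> 0"
      unfolding gprod_orthonormal_square(1)[OF sym oP, of v, OF IntD2[OF v]]
      by (rule sum_nonneg) (auto simp: P'_def)
    moreover have "gprod g x v v < 0" if nz: "v \<noteq> 0"
    proof -
      obtain e where e: "e \<in> N" "gprod g x v e \<noteq> 0"
        using gprod_orthonormal_square(2)[where g = g and x = x, OF sym oN IntD1[OF v] nz] by blast
      have "gprod g x f f * (gprod g x v f)\<^sup>2 \<le> 0" if "f \<in> N" for f
        using that by (auto simp: N_def intro: mult_nonpos_nonneg)
      moreover have "gprod g x e e * (gprod g x v e)\<^sup>2 < 0"
        using e by (auto simp: N_def intro: mult_neg_pos)
      ultimately have "(\<Sum>e\<in>N. gprod g x e e * (gprod g x v e)\<^sup>2) < (\<Sum>e\<in>N. 0)"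
        using oN e(1) by (intro sum_strict_mono_ex1) (auto simp: orthonormal_set_def)
      then show ?thesis unfolding gprod_orthonormal_square(1)[OF sym oN IntD1[OF v]] by simp
    qed
    ultimately show "v \<in> {0}" by force
  qed
  then have "dim (span N \<inter> span P') = 0" by simp
  then have "dim {a + b |a b. a \<in> span N \<and> b \<in> span P'} = dim N + dim P'"
    using dim_sums_Int[OF subspace_span subspace_span, of N P'] dim_span[of N] dim_span[of P'] by linarith
  also have "\<dots> = card N + card P'"
    using dim_eq_card_independent oN oP orthonormal_set_independent by metis
  finally have "card N + card P' = dim {a + b |a b. a \<in> span N \<and> b \<in> span P'}" by simp
  also have "\<dots> \<le> dim V"
  proof (rule dim_subset)
    have "span N \<subseteq> V" "span P' \<subseteq> V"
      using span_mono[of N B] span_mono[of P' B'] sp by (auto simp: N_def P'_def)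
    then show "{a + b |a b. a \<in> span N \<and> b \<in> span P'} \<subseteq> V"
      using span_add sp by blast
  qed
  also have "\<dots> = card B'"
    using sp(2) dim_span[of B'] dim_eq_card_independent[OF orthonormal_set_independent[OF o(2)]] by simp
  also have "B' = N' \<union> P'"
    using o(2) unfolding orthonormal_set_def N'_def P'_def by force
  also have "card \<dots> = card N' + card P'"
    using o(2) by (intro card_Un_disjoint) (auto simp: orthonormal_set_def N'_def P'_def)
  finally show ?thesis by (simp add: N_def N'_def)
qed

lemma orthonormal_inertia:
  assumes "transpose (g x) = g x" "orthonormal_basis g x V B" "orthonormal_basis g x V B'"
  shows "card {e\<in>B. gprod g x e e < 0} = card {e\<in>B'. gprod g x e e < 0}" (is "card ?n = card ?n'")
    and "card {e\<in>B. gprod g x e e > 0} = card {e\<in>B'. gprod g x e e > 0}"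
      (is "card ?p = card ?p'")
proof -
  show n: "card ?n = card ?n'"
    using orthonormal_inertia_le[OF assms] orthonormal_inertia_le[OF assms(1,3,2)] by simp
  have split: "card {e\<in>B. gprod g x e e < 0} + card {e\<in>B. gprod g x e e > 0} = dim V"
    if B: "orthonormal_basis g x V B" for B
  proof -
    have o: "orthonormal_set g x B" using B by (simp add: orthonormal_basis_iff)
    have "card {e\<in>B. gprod g x e e < 0} + card {e\<in>B. gprod g x e e > 0}
        = card ({e\<in>B. gprod g x e e < 0} \<union> {e\<in>B. gprod g x e e > 0})"
      using o by (intro card_Un_disjoint[symmetric]) (auto simp: orthonormal_set_def)
    also have "{e\<in>B. gprod g x e e < 0} \<union> {e\<in>B. gprod g x e e > 0} = B"
      using o unfolding orthonormal_set_def by force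
    also have "card B = dim V"
      using B dim_eq_card[of B V] span_eq_iff[of V] unfolding orthonormal_basis_def by (metis span_span)
    finally show ?thesis .
  qed
  show "card ?p = card ?p'" using n split[OF assms(2)] split[OF assms(3)] by simp
qed

text \<open>By inertia every orthonormal basis that extends \<open>B\<close> has the signature \<open>(p,q)\<close> of the metric.\<close>

lemma orthonormal_complement:
  assumes sym: "transpose (g x) = g x" and U: "UNIV \<in> Gr g p q x"
    and B: "orthonormal_set g x B"
    and r: "card {e\<in>B. gprod g x e e < 0} = r" and s: "card {e\<in>B. gprod g x e e > 0} = s"
  obtains T where "B \<inter> T = {}" "orthonormal_basis g x UNIV (B \<union> T)"
    "card {e\<in>T. gprod g x e e < 0} = p - r" "card {e\<in>T. gprod g x e e > 0} = q - s"
proof -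
  obtain E where E: "orthonormal_basis g x UNIV E"
    "card {e\<in>E. gprod g x e e < 0} = p" "card {e\<in>E. gprod g x e e > 0} = q"
    and nd: "nondegenerate_on g x UNIV"
    using U unfolding Gr_def by blast
  obtain C where C: "B \<subseteq> C" "orthonormal_basis g x UNIV C"
    using orthonormal_extend[OF sym nd B] .
  have fC: "finite C" using C(2) by (simp add: orthonormal_basis_iff orthonormal_set_def)
  have "card {e\<in>C. gprod g x e e < 0} = p" "card {e\<in>C. gprod g x e e > 0} = q"
    using orthonormal_inertia[OF sym C(2) E(1)] E(2,3) by simp_all
  moreover have "card {e\<in>C - B. Q e} = card {e\<in>C. Q e} - card {e\<in>B. Q e}" for Q
  proof -
    have "{e\<in>C - B. Q e} = {e\<in>C. Q e} - {e\<in>B. Q e}" by blast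
    moreover have "{e\<in>B. Q e} \<subseteq> {e\<in>C. Q e}" using C(1) by blast
    moreover have "finite {e\<in>B. Q e}" using finite_subset[OF C(1) fC] by simp
    ultimately show ?thesis by (simp only: card_Diff_subset)
  qed
  ultimately show ?thesis
    using that[of "C - B"] C r s by (simp add: Un_absorb1)
qed

section \<open>Symmetry of second derivatives\<close>

text \<open>The mean value theorem along \<open>u\<close> and then along \<open>v\<close>.\<close>

lemma mean_value_mixed:
  fixes f :: "'a::real_normed_vector \<Rightarrow> real"
  assumes D: "\<And>y. (f has_derivative f' y) (at y)"
    and D2: "\<And>y. ((\<lambda>z. f' z u) has_derivative f'' y) (at y)" and h: "0 < h"
  obtains s t where "0 < s" "s < h" "0 < t" "t < h"
    "f (x + h *\<^sub>R u + h *\<^sub>R v) - f (x + h *\<^sub>R u) - f (x + h *\<^sub>R v) + f x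
       = h * h * f'' (x + s *\<^sub>R u + t *\<^sub>R v) v"
proof -
  have line: "((\<lambda>s. F (c + s *\<^sub>R w)) has_real_derivative F' (c + s *\<^sub>R w) w) (at s)"
    if F: "\<And>y. (F has_derivative F' y) (at y)" for F :: "'a \<Rightarrow> real" and F' c w s
  proof -
    have "((\<lambda>s. c + s *\<^sub>R w) has_derivative (\<lambda>d. d *\<^sub>R w)) (at s)"
      by (auto intro!: derivative_eq_intros)
    from has_derivative_compose[OF this F]
    have "((\<lambda>s. F (c + s *\<^sub>R w)) has_derivative (\<lambda>d. F' (c + s *\<^sub>R w) (d *\<^sub>R w))) (at s)" .
    then show ?thesis
      using linear_cmul[OF has_derivative_linear[OF F]]
      by (simp add: has_field_derivative_def mult_commute_abs)
  qed
  define G where "G s = f ((x + h *\<^sub>R v) + s *\<^sub>R u) - f (x + s *\<^sub>R u)" for s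
  have "(G has_real_derivative f' ((x + h *\<^sub>R v) + s *\<^sub>R u) u - f' (x + s *\<^sub>R u) u) (at s)" for s
    unfolding G_def by (intro DERIV_diff line D)
  then obtain s where s: "0 < s" "s < h"
    "G h - G 0 = (h - 0) * (f' ((x + h *\<^sub>R v) + s *\<^sub>R u) u - f' (x + s *\<^sub>R u) u)"
    using MVT2[of 0 h G "\<lambda>s. f' ((x + h *\<^sub>R v) + s *\<^sub>R u) u - f' (x + s *\<^sub>R u) u"] h by blast
  have "((\<lambda>t. f' ((x + s *\<^sub>R u) + t *\<^sub>R v) u) has_real_derivative f'' ((x + s *\<^sub>R u) + t *\<^sub>R v) v) (at t)" for t
    by (rule line[OF D2])
  then obtain t where t: "0 < t" "t < h"
    "f' ((x + s *\<^sub>R u) + h *\<^sub>R v) u - f' ((x + s *\<^sub>R u) + 0 *\<^sub>R v) u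
      = (h - 0) * f'' ((x + s *\<^sub>R u) + t *\<^sub>R v) v"
    using MVT2[of 0 h "\<lambda>t. f' ((x + s *\<^sub>R u) + t *\<^sub>R v) u" "\<lambda>t. f'' ((x + s *\<^sub>R u) + t *\<^sub>R v) v"] h by blast
  have "f (x + h *\<^sub>R u + h *\<^sub>R v) - f (x + h *\<^sub>R u) - f (x + h *\<^sub>R v) + f x = G h - G 0"
    by (simp add: G_def algebra_simps)
  also have "\<dots> = h * (f' ((x + s *\<^sub>R u) + h *\<^sub>R v) u - f' ((x + s *\<^sub>R u) + 0 *\<^sub>R v) u)"
    using s(3) by (simp add: algebra_simps)
  also have "\<dots> = h * h * f'' (x + s *\<^sub>R u + t *\<^sub>R v) v" unfolding t(3) by simp
  finally show ?thesis using that s(1,2) t(1,2) by blast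
qed

text \<open>The second difference over the parallelogram with sides \<open>h u\<close>, \<open>h v\<close> is symmetric in \<open>u\<close> and \<open>v\<close>,
  and is \<open>h\<^sup>2\<close> times either mixed derivative at a point that tends to \<open>x\<close> with \<open>h\<close>.\<close>

lemma second_derivative_symmetric_real:
  fixes f :: "'a::real_normed_vector \<Rightarrow> real"
  assumes D: "\<And>y. (f has_derivative f' y) (at y)"
    and D2: "\<And>y u. ((\<lambda>z. f' z u) has_derivative f'' y u) (at y)"
    and cont: "\<And>u v. continuous_on UNIV (\<lambda>y. f'' y u v)"
  shows "f'' x u v = f'' x v u"
proof -
  have lim: "\<exists>p. p \<longlonglongrightarrow> x \<and> (\<forall>n. f'' (p n) u v * (h n * h n) = Q (h n))"
    if Q: "\<And>h. Q h = f (x + h *\<^sub>R u + h *\<^sub>R v) - f (x + h *\<^sub>R u) - f (x + h *\<^sub>R v) + f x"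
      and h: "\<And>n. 0 < h n" "h \<longlonglongrightarrow> 0" for u v Q and h :: "nat \<Rightarrow> real"
  proof -
    have "\<exists>s t. 0 < s \<and> s < h n \<and> 0 < t \<and> t < h n \<and>
        Q (h n) = h n * h n * f'' (x + s *\<^sub>R u + t *\<^sub>R v) u v" for n
      using mean_value_mixed[of f f' u "\<lambda>y. f'' y u" "h n" x v, OF D D2 h(1)] unfolding Q by metis
    then obtain s t where st: "\<And>n. 0 < s n" "\<And>n. s n < h n" "\<And>n. 0 < t n" "\<And>n. t n < h n"
        "\<And>n. Q (h n) = h n * h n * f'' (x + s n *\<^sub>R u + t n *\<^sub>R v) u v"
      by metis
    have "s \<longlonglongrightarrow> 0" "t \<longlonglongrightarrow> 0"
      using st by (auto intro!: tendsto_sandwich[OF _ _ tendsto_const h(2)] always_eventually less_imp_le)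
    then have "(\<lambda>n. x + s n *\<^sub>R u + t n *\<^sub>R v) \<longlonglongrightarrow> x + 0 *\<^sub>R u + 0 *\<^sub>R v"
      by (intro tendsto_intros)
    then show ?thesis using st(5)
      by (intro exI[of _ "\<lambda>n. x + s n *\<^sub>R u + t n *\<^sub>R v"]) (simp add: mult.commute)
  qed
  define h :: "nat \<Rightarrow> real" where "h n = inverse (real (Suc n))" for n
  have h: "\<And>n. 0 < h n" "h \<longlonglongrightarrow> 0"
    unfolding h_def using LIMSEQ_inverse_real_of_nat by simp_all
  define Q where "Q h = f (x + h *\<^sub>R u + h *\<^sub>R v) - f (x + h *\<^sub>R u) - f (x + h *\<^sub>R v) + f x" for h
  obtain p where p: "p \<longlonglongrightarrow> x" "\<And>n. f'' (p n) u v * (h n * h n) = Q (h n)"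
    using lim[of Q u v h] h Q_def by blast
  obtain q where q: "q \<longlonglongrightarrow> x" "\<And>n. f'' (q n) v u * (h n * h n) = Q (h n)"
    using lim[of Q v u h] h by (auto simp: Q_def algebra_simps)
  have "f'' (p n) u v = f'' (q n) v u" for n
    using p(2)[of n] q(2)[of n] h(1)[of n] by (metis mult_cancel_right less_irrefl mult_eq_0_iff)
  moreover have "(\<lambda>n. f'' (p n) u v) \<longlonglongrightarrow> f'' x u v" "(\<lambda>n. f'' (q n) v u) \<longlonglongrightarrow> f'' x v u"
    by (rule continuous_on_tendsto_compose[OF cont p(1)], simp_all)
      (rule continuous_on_tendsto_compose[OF cont q(1)], simp_all)
  ultimately show ?thesis using LIMSEQ_unique by simp
qed

lemma second_derivative_symmetric:
  fixes f :: "'a::real_normed_vector \<Rightarrow> 'b::real_inner"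
  assumes D: "\<And>y. (f has_derivative f' y) (at y)"
    and D2: "\<And>y u. ((\<lambda>z. f' z u) has_derivative f'' y u) (at y)"
    and cont: "\<And>u v. continuous_on UNIV (\<lambda>y. f'' y u v)"
  shows "f'' x u v = f'' x v u"
proof -
  have "f'' x u v \<bullet> b = f'' x v u \<bullet> b" for b
  proof (rule second_derivative_symmetric_real[of "\<lambda>y. f y \<bullet> b" "\<lambda>y v. f' y v \<bullet> b" "\<lambda>y u v. f'' y u v \<bullet> b"])
    show "((\<lambda>y. f y \<bullet> b) has_derivative (\<lambda>v. f' y v \<bullet> b)) (at y)" for y
      by (rule has_derivative_inner_left[OF D])
    show "((\<lambda>z. f' z u \<bullet> b) has_derivative (\<lambda>v. f'' y u v \<bullet> b)) (at y)" for y u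
      by (rule has_derivative_inner_left[OF D2])
    show "continuous_on UNIV (\<lambda>y. f'' y u v \<bullet> b)" for u v
      by (intro continuous_intros cont)
  qed
  then show ?thesis using vector_eq_rdot by blast
qed

section \<open>The curvature of \<open>g\<^sub>\<psi>\<close>\<close>

definition D1 :: "(real^'n::finite \<Rightarrow> real^'n^'n) \<Rightarrow> real^'n \<Rightarrow> real^'n \<Rightarrow> real^'n^'n" where
  "D1 \<psi> x v = frechet_derivative \<psi> (at x) v"

definition D2 :: "(real^'n::finite \<Rightarrow> real^'n^'n) \<Rightarrow> real^'n \<Rightarrow> real^'n \<Rightarrow> real^'n \<Rightarrow> real^'n^'n" where
  "D2 \<psi> x v u = frechet_derivative (\<lambda>y. D1 \<psi> y v) (at x) u"

lemma smooth_sym2_derivatives: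
  fixes \<psi> :: "real^'n::finite \<Rightarrow> real^'n^'n"
  assumes \<psi>: "smooth_sym2_tensor \<psi>"
  shows has_derivative_D1: "(\<psi> has_derivative D1 \<psi> x) (at x)"
    and has_derivative_D2: "((\<lambda>y. D1 \<psi> y v) has_derivative D2 \<psi> x v) (at x)"
    and D2_commute: "D2 \<psi> x u v = D2 \<psi> x v u"
    and bilinear_D2: "bilinear (D2 \<psi> x)"
    and transpose_D1: "transpose (D1 \<psi> x u) = D1 \<psi> x u"
    and transpose_D2: "transpose (D2 \<psi> x u v) = D2 \<psi> x u v"
proof -
  have ck: "Ck (Suc (Suc 0)) \<psi>" using \<psi> unfolding smooth_sym2_tensor_def smooth_def by blast
  show d1: "(\<psi> has_derivative D1 \<psi> x) (at x)" for x
    using ck unfolding D1_def[abs_def] by (simp add: frechet_derivative_works[symmetric])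
  show d2: "((\<lambda>y. D1 \<psi> y v) has_derivative D2 \<psi> x v) (at x)" for x v
    using ck unfolding D1_def[abs_def] D2_def[abs_def] by (simp add: frechet_derivative_works[symmetric])
  have cont: "continuous_on UNIV (\<lambda>y. D2 \<psi> y u v)" for u v
    using ck unfolding D1_def[abs_def] D2_def[abs_def] by simp
  show cm: "D2 \<psi> x u v = D2 \<psi> x v u" for u v
    by (rule second_derivative_symmetric[OF d1 d2 cont])
  have "linear (D2 \<psi> x v)" for v using d2 has_derivative_linear by blast
  then show "bilinear (D2 \<psi> x)"
    unfolding bilinear_def by (simp add: cm[of _ v for v])
  have "bounded_linear (transpose :: real^'n^'n \<Rightarrow> _)"
    by (intro linear_conv_bounded_linear[THEN iffD1] linearI) (simp_all add: transpose_def vec_eq_iff)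
  note T = bounded_linear.has_derivative[OF this]
  show t1: "transpose (D1 \<psi> y u) = D1 \<psi> y u" for y u
  proof -
    have "transpose (\<psi> y) = \<psi> y" for y using \<psi> by (simp add: smooth_sym2_tensor_def)
    then have "(\<psi> has_derivative (\<lambda>u. transpose (D1 \<psi> y u))) (at y)" using T[OF d1[of y]] by simp
    from has_derivative_unique[OF this d1] show ?thesis by metis
  qed
  have "((\<lambda>y. D1 \<psi> y u) has_derivative (\<lambda>v. transpose (D2 \<psi> x u v))) (at x)"
    using T[OF d2[of u x]] by (simp add: t1)
  from has_derivative_unique[OF this d2] show "transpose (D2 \<psi> x u v) = D2 \<psi> x u v" by metis
qed

text \<open>The Koszul formula: for \<open>L = D1 \<psi> x\<close> and constant fields \<open>v\<close>, \<open>w\<close> this is the covariant derivative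
  of \<open>w\<close> along \<open>v\<close>. It is linear in \<open>L\<close>, so that its derivative in \<open>x\<close> is the same expression with
  the derivative of \<open>L\<close>.\<close>

definition koszul :: "(real^'n::finite \<Rightarrow> real^'n^'n) \<Rightarrow> real^'n \<Rightarrow> real^'n \<Rightarrow> real^'n" where
  "koszul L v w = (1/2) *\<^sub>R (L v *v w + L w *v v - (\<Sum>k\<in>UNIV. (v \<bullet> (L (axis k 1) *v w)) *\<^sub>R axis k 1))"

lemma koszul_nth: 
  "koszul L v w $ k = (1/2) * ((L v *v w) $ k + (L w *v v) $ k - v \<bullet> (L (axis k 1) *v w))"
  by (simp add: koszul_def axis_def if_distrib cong: if_cong)

lemma koszul_inner:
  assumes "linear L"
  shows "koszul L v w \<bullet> t = (1/2) * (t \<bullet> (L v *v w) + t \<bullet> (L w *v v) - v \<bullet> (L t *v w))"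
proof -
  have lin: "linear (\<lambda>a. v \<bullet> (L a *v w))"
    by (rule linearI) (simp_all add: linear_add[OF assms] linear_cmul[OF assms]
        matrix_vector_mult_add_rdistrib scaleR_matrix_vector_assoc[symmetric] inner_add_right)
  have "t = (\<Sum>k\<in>UNIV. t $ k *\<^sub>R axis k 1)"
    using basis_expansion[of t] by (simp add: scalar_mult_eq_scaleR)
  then have "v \<bullet> (L t *v w) = v \<bullet> (L (\<Sum>k\<in>UNIV. t $ k *\<^sub>R axis k 1) *v w)" by simp
  also have "\<dots> = (\<Sum>k\<in>UNIV. t $ k * (v \<bullet> (L (axis k 1) *v w)))"
    using linear_sum[OF lin, of "\<lambda>k. t $ k *\<^sub>R axis k 1" UNIV] linear_cmul[OF lin] by simp
  also have "\<dots> = (\<Sum>k\<in>UNIV. (v \<bullet> (L (axis k 1) *v w)) *\<^sub>R axis k 1) \<bullet> t"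
    by (simp add: inner_sum_left inner_axis' mult.commute)
  finally show ?thesis
    by (simp add: koszul_def inner_diff_right inner_add_right inner_commute[of _ t])
qed

text \<open>A vector in the kernel of the matrix is orthogonal to everything.\<close>

lemma invertible_g_psi:
  fixes \<psi> :: "real^'n::finite \<Rightarrow> real^'n^'n"
  assumes "smooth_sym2_tensor \<psi>"
  shows "invertible (g_psi \<psi> z)"
proof -
  have "nondegenerate_on (g_psi \<psi>) z UNIV"
    using g_psi_pseudo_riemannian[OF assms] unfolding pseudo_riemannian_def Gr_def by blast
  moreover have "gprod (g_psi \<psi>) z u v = gprod (g_psi \<psi>) z v u" for u v
    using g_psi_pseudo_riemannian[OF assms] unfolding pseudo_riemannian_def by (intro gprod_commute) blast
  ultimately have "g_psi \<psi> z *v u = 0 \<Longrightarrow> u = 0" for u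
    unfolding nondegenerate_on_def gprod_def by (metis UNIV_I inner_zero_right)
  then show ?thesis
    using invertible_left_inverse matrix_left_invertible_ker by blast
qed

lemma partial_g_psi:
  assumes \<psi>: "smooth_sym2_tensor \<psi>"
  shows "partial (Inl i) (\<lambda>y. g_psi \<psi> y $ Inl j $ Inl k) z = D1 \<psi> (xpart z) (axis i 1) $ j $ k"
    and "partial (Inr l) (\<lambda>y. g_psi \<psi> y $ b $ c) z = 0"
    and "partial a (\<lambda>y. g_psi \<psi> y $ Inr l $ c) z = 0"
    and "partial a (\<lambda>y. g_psi \<psi> y $ b $ Inr l) z = 0"
proof -
  have const: "partial a (\<lambda>y. C) z = 0" for a and C :: real
    unfolding partial_def by (simp add: frechet_derivative_const)
  have xx: "((\<lambda>y. g_psi \<psi> y $ Inl j $ Inl k) has_derivative (\<lambda>u. D1 \<psi> (xpart z) (xpart u) $ j $ k)) (at z)"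
    for j k
  proof -
    have "(xpart has_derivative xpart) (at z)"
      using linear_xpart linear_conv_bounded_linear bounded_linear_imp_has_derivative by blast
    from has_derivative_compose[OF this has_derivative_D1[OF \<psi>]]
    have "((\<lambda>y. \<psi> (xpart y) $ j $ k) has_derivative (\<lambda>u. D1 \<psi> (xpart z) (xpart u) $ j $ k)) (at z)"
      by (intro bounded_linear.has_derivative[OF bounded_linear_vec_nth])
    then show ?thesis by (simp add: g_psi_def)
  qed
  have ax: "xpart (axis (Inl i) 1) = (axis i 1 :: real^'a)" "xpart (axis (Inr l) 1) = (0 :: real^'a)" for i l
    by (simp_all add: vec_eq_iff axis_def)
  show "partial (Inl i) (\<lambda>y. g_psi \<psi> y $ Inl j $ Inl k) z = D1 \<psi> (xpart z) (axis i 1) $ j $ k"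
    unfolding partial_def frechet_derivative_at[OF xx, symmetric] ax ..
  show c: "partial a (\<lambda>y. g_psi \<psi> y $ Inr l $ c) z = 0" for a l c
    by (cases c) (simp_all add: g_psi_def const)
  show r: "partial a (\<lambda>y. g_psi \<psi> y $ b $ Inr l) z = 0" for a b l
    by (cases b) (simp_all add: g_psi_def const)
  have "D1 \<psi> (xpart z) 0 = 0" using has_derivative_D1[OF \<psi>] has_derivative_linear linear_0 by blast
  then have "partial (Inr l) (\<lambda>y. g_psi \<psi> y $ Inl j $ Inl k) z = 0" for j k
    unfolding partial_def frechet_derivative_at[OF xx, symmetric] ax by simp
  then show "partial (Inr l) (\<lambda>y. g_psi \<psi> y $ b $ c) z = 0"
    using c r by (cases b; cases c) auto
qed

lemma sum_UNIV_Plus: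
  fixes f :: "'a::finite + 'b::finite \<Rightarrow> 'c::comm_monoid_add"
  shows "sum f UNIV = (\<Sum>i\<in>UNIV. f (Inl i)) + (\<Sum>i\<in>UNIV. f (Inr i))"
  unfolding UNIV_Plus_UNIV[symmetric] by (subst sum.Plus) auto

text \<open>Lowering the upper index avoids the inverse matrix: the rows \<open>Inr m\<close> of \<open>g\<^sub>\<psi>\<close> give the
  symbols with upper index \<open>Inl m\<close>, and then the rows \<open>Inl m\<close> give those with upper index \<open>Inr m\<close>.\<close>

lemma christoffel_g_psi:
  fixes \<psi> :: "real^'n::finite \<Rightarrow> real^'n^'n"
  assumes \<psi>: "smooth_sym2_tensor \<psi>"
  shows "christoffel (g_psi \<psi>) z (Inl k) a b = 0"
    and "christoffel (g_psi \<psi>) z (Inr k) (Inl i) (Inl j) = (1/2) * (D1 \<psi> (xpart z) (axis i 1) $ j $ k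
       + D1 \<psi> (xpart z) (axis j 1) $ i $ k - D1 \<psi> (xpart z) (axis k 1) $ i $ j)"
    and "christoffel (g_psi \<psi>) z (Inr k) (Inr i) b = 0"
    and "christoffel (g_psi \<psi>) z (Inr k) a (Inr j) = 0"
proof -
  have delta: "(if k = i then 1 else 0) * (c :: real) = (if k = i then c else 0)" for k i :: 'n and c
    by simp
  have "transpose (g_psi \<psi> x) = g_psi \<psi> x" for x
    using g_psi_pseudo_riemannian[OF \<psi>] unfolding pseudo_riemannian_def by blast
  note low = g_christoffel[of "g_psi \<psi>" z, OF this invertible_g_psi[OF \<psi>]]
  show l: "christoffel (g_psi \<psi>) z (Inl k) a b = 0" for k a b
    using low[of "Inr k" a b]
    by (simp add: sum_UNIV_Plus g_psi_def[of \<psi> z] partial_g_psi[OF \<psi>] delta)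
  have r: "christoffel (g_psi \<psi>) z (Inr k) a b = (1/2) * (partial a (\<lambda>y. g_psi \<psi> y $ b $ Inl k) z
      + partial b (\<lambda>y. g_psi \<psi> y $ a $ Inl k) z - partial (Inl k) (\<lambda>y. g_psi \<psi> y $ a $ b) z)" for k a b
    using low[of "Inl k" a b]
    by (simp add: sum_UNIV_Plus g_psi_def[of \<psi> z] l delta)
  show "christoffel (g_psi \<psi>) z (Inr k) (Inl i) (Inl j) = (1/2) * (D1 \<psi> (xpart z) (axis i 1) $ j $ k
       + D1 \<psi> (xpart z) (axis j 1) $ i $ k - D1 \<psi> (xpart z) (axis k 1) $ i $ j)"
    "christoffel (g_psi \<psi>) z (Inr k) (Inr i) b = 0" "christoffel (g_psi \<psi>) z (Inr k) a (Inr j) = 0"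
    unfolding r by (simp_all add: partial_g_psi[OF \<psi>])
qed

text \<open>The \<open>y\<close>-part of \<open>R(u,v)w\<close>, as a function of the \<open>x\<close>-parts of \<open>u\<close>, \<open>v\<close>, \<open>w\<close>.\<close>

definition riemann :: "(real^'n::finite \<Rightarrow> real^'n^'n) \<Rightarrow> real^'n \<Rightarrow> real^'n \<Rightarrow> real^'n \<Rightarrow> real^'n \<Rightarrow> real^'n" where
  "riemann \<psi> x u v w = koszul (\<lambda>a. D2 \<psi> x a u) v w - koszul (\<lambda>a. D2 \<psi> x a v) u w"

lemma christoffel_term_g_psi:
  fixes \<psi> :: "real^'n::finite \<Rightarrow> real^'n^'n"
  assumes \<psi>: "smooth_sym2_tensor \<psi>"
  shows "(\<chi> k. \<Sum>i\<in>UNIV. \<Sum>j\<in>UNIV. christoffel (g_psi \<psi>) z k i j * v $ i * w $ j)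
    = xy 0 (koszul (D1 \<psi> (xpart z)) (xpart v) (xpart w))" (is "?l = ?r")
proof (rule vec_plus_eqI)
  fix k
  show "?l $ Inl k = ?r $ Inl k" by (simp add: christoffel_g_psi[OF \<psi>])
  let ?D = "D1 \<psi> (xpart z)"
  have "linear ?D" using has_derivative_D1[OF \<psi>] has_derivative_linear by blast
  have D: "(\<Sum>i\<in>UNIV. v $ i * ?D (axis i 1) $ a $ b) = ?D v $ a $ b" for v a b
  proof -
    have "v = (\<Sum>i\<in>UNIV. v $ i *\<^sub>R axis i 1)"
      using basis_expansion[of v] by (simp add: scalar_mult_eq_scaleR)
    then have "?D v = ?D (\<Sum>i\<in>UNIV. v $ i *\<^sub>R axis i 1)" by simp
    also have "\<dots> = (\<Sum>i\<in>UNIV. v $ i *\<^sub>R ?D (axis i 1))"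
      by (simp add: linear_sum[OF \<open>linear ?D\<close>] linear_cmul[OF \<open>linear ?D\<close>])
    finally show ?thesis by simp
  qed
  let ?v = "xpart v" and ?w = "xpart w"
  have "?l $ Inr k = (\<Sum>i\<in>UNIV. \<Sum>j\<in>UNIV. (1/2) * (?D (axis i 1) $ j $ k
      + ?D (axis j 1) $ i $ k - ?D (axis k 1) $ i $ j) * ?v $ i * ?w $ j)"
    by (simp add: sum_UNIV_Plus christoffel_g_psi[OF \<psi>])
  also have "\<dots> = (1/2) * ((\<Sum>i\<in>UNIV. \<Sum>j\<in>UNIV. ?v $ i * ?D (axis i 1) $ j $ k * ?w $ j)
      + (\<Sum>i\<in>UNIV. \<Sum>j\<in>UNIV. ?w $ j * ?D (axis j 1) $ i $ k * ?v $ i)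
      - (\<Sum>i\<in>UNIV. \<Sum>j\<in>UNIV. ?v $ i * (?D (axis k 1) $ i $ j * ?w $ j)))"
    by (simp add: sum_distrib_left sum.distrib[symmetric] sum_subtractf[symmetric] algebra_simps)
  also have "(\<Sum>i\<in>UNIV. \<Sum>j\<in>UNIV. ?v $ i * ?D (axis i 1) $ j $ k * ?w $ j) 
      = (\<Sum>j\<in>UNIV. ?D ?v $ j $ k * ?w $ j)"
    by (subst sum.swap) (simp only: sum_distrib_right[symmetric] D)
  also have "(\<Sum>i\<in>UNIV. \<Sum>j\<in>UNIV. ?w $ j * ?D (axis j 1) $ i $ k * ?v $ i)
      = (\<Sum>i\<in>UNIV. ?D ?w $ i $ k * ?v $ i)"
    by (simp only: sum_distrib_right[symmetric] D)
  also have "(\<Sum>i\<in>UNIV. \<Sum>j\<in>UNIV. ?v $ i * (?D (axis k 1) $ i $ j * ?w $ j))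
      = ?v \<bullet> (?D (axis k 1) *v ?w)"
    by (simp add: inner_vec_def matrix_vector_mult_def sum_distrib_left)
  finally have L: "?l $ Inr k = (1/2) * ((\<Sum>j\<in>UNIV. ?D ?v $ j $ k * ?w $ j)
    + (\<Sum>i\<in>UNIV. ?D ?w $ i $ k * ?v $ i) - ?v \<bullet> (?D (axis k 1) *v ?w))" .
  have "?D u $ i $ k = ?D u $ k $ i" for u i
    by (rule symmetric_nth[OF transpose_D1[OF \<psi>]])
  then show "?l $ Inr k = ?r $ Inr k"
    unfolding L by (simp add: koszul_nth matrix_vector_mult_def)
qed

text \<open>Covariant derivatives of constant fields point in the \<open>y\<close>-directions, on which the Christoffel
  symbols vanish. The terms of the curvature that are quadratic in the symbols thus disappear, and
  only their derivatives remain.\<close>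

theorem curv_at_g_psi:
  fixes \<psi> :: "real^'n::finite \<Rightarrow> real^'n^'n"
  assumes \<psi>: "smooth_sym2_tensor \<psi>"
  shows "curv_at (g_psi \<psi>) z u v w = xy 0 (riemann \<psi> (xpart z) (xpart u) (xpart v) (xpart w))"
proof -
  let ?g = "g_psi \<psi>"
  have fc: "frechet_derivative (\<lambda>_. c) (at y) = (\<lambda>_. 0)" for c :: "real^('n + 'n)" and y
    by (rule frechet_derivative_const)
  have n1: "nabla ?g (\<lambda>_. a) (\<lambda>_. b) = (\<lambda>z. xy 0 (koszul (D1 \<psi> (xpart z)) (xpart a) (xpart b)))" for a b
    by (simp add: fun_eq_iff nabla_def fc christoffel_term_g_psi[OF \<psi>])
  have der: "((\<lambda>z. xy 0 (koszul (D1 \<psi> (xpart z)) b c)) has_derivative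
      (\<lambda>a. xy 0 (koszul (\<lambda>e. D2 \<psi> (xpart z) e (xpart a)) b c))) (at z)" for b c
  proof -
    have lin: "bounded_linear (\<lambda>M :: real^'n^'n. M *v c)" for c
      by (intro linear_conv_bounded_linear[THEN iffD1] linearI)
        (simp_all add: matrix_vector_mult_add_rdistrib scaleR_matrix_vector_assoc)
    have x: "(xpart has_derivative xpart) (at z)"
      using linear_xpart linear_conv_bounded_linear bounded_linear_imp_has_derivative by blast
    have d: "((\<lambda>z. D1 \<psi> (xpart z) e *v c) has_derivative (\<lambda>a. D2 \<psi> (xpart z) e (xpart a) *v c)) (at z)" for e c
      by (rule bounded_linear.has_derivative[OF lin has_derivative_compose[OF x has_derivative_D2[OF \<psi>]]])
    have "((\<lambda>z. koszul (D1 \<psi> (xpart z)) b c) has_derivative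
        (\<lambda>a. koszul (\<lambda>e. D2 \<psi> (xpart z) e (xpart a)) b c)) (at z)"
      unfolding koszul_def
      by (intro has_derivative_scaleR_right has_derivative_diff has_derivative_add d has_derivative_sum
          has_derivative_scaleR_left has_derivative_inner_right)
    moreover have "bounded_linear (xy 0 :: real^'n \<Rightarrow> _)"
      using linear_xy0 linear_conv_bounded_linear by blast
    ultimately show ?thesis by (rule bounded_linear.has_derivative[rotated])
  qed
  have n2: "nabla ?g (\<lambda>_. a) (nabla ?g (\<lambda>_. b) (\<lambda>_. c)) z
      = xy 0 (koszul (\<lambda>e. D2 \<psi> (xpart z) e (xpart a)) (xpart b) (xpart c))" for a b c
  proof -
    have k0: "koszul (D1 \<psi> (xpart z)) (xpart a) 0 = 0"
    proof -
      have "D1 \<psi> (xpart z) 0 = 0" using has_derivative_D1[OF \<psi>] has_derivative_linear linear_0 by blast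
      then show ?thesis by (simp add: koszul_def)
    qed
    show ?thesis
      unfolding n1 nabla_def[of ?g "\<lambda>_. a"] frechet_derivative_at[OF der, symmetric]
        christoffel_term_g_psi[OF \<psi>] by (simp add: k0)
  qed
  have "lie_bracket (\<lambda>_. u) (\<lambda>_. v) = (\<lambda>_. 0)" by (simp add: fun_eq_iff lie_bracket_def fc)
  moreover have "koszul (D1 \<psi> (xpart z)) 0 (xpart w) = 0"
  proof -
    have "D1 \<psi> (xpart z) 0 = 0" using has_derivative_D1[OF \<psi>] has_derivative_linear linear_0 by blast
    then show ?thesis by (simp add: koszul_def)
  qed
  then have "nabla ?g (\<lambda>_. 0) (\<lambda>_. w) z = 0" unfolding n1 by simp
  ultimately show ?thesis
    unfolding curv_at_def curvature_def by (simp add: n2 riemann_def xy_arith)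
qed

section \<open>The Jacobi operators of \<open>g\<^sub>\<psi>\<close>\<close>

lemma linear_D2_arg:
  assumes "smooth_sym2_tensor \<psi>"
  shows "linear (\<lambda>a. D2 \<psi> x a u)"
  using bilinear_D2[OF assms] unfolding bilinear_def by blast

text \<open>Of the six terms of the two Koszul expressions, the first terms of both cancel by the symmetry
  of second derivatives; the other four show the symmetries of the curvature tensor.\<close>

lemma riemann_inner:
  assumes \<psi>: "smooth_sym2_tensor \<psi>"
  shows "riemann \<psi> x u v w \<bullet> t = (1/2) * (t \<bullet> (D2 \<psi> x u w *v v) - v \<bullet> (D2 \<psi> x u t *v w)
     - t \<bullet> (D2 \<psi> x v w *v u) + u \<bullet> (D2 \<psi> x v t *v w))"
  unfolding riemann_def inner_diff_left koszul_inner[OF linear_D2_arg[OF \<psi>]]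
  by (simp add: D2_commute[OF \<psi>, of x v u] D2_commute[OF \<psi>, of x w] D2_commute[OF \<psi>, of x t] algebra_simps)

lemma riemann_multilinear:
  assumes \<psi>: "smooth_sym2_tensor \<psi>"
  shows bilinear_riemann: "bilinear (\<lambda>v w. riemann \<psi> x u v w)"
    and linear_riemann: "linear (\<lambda>u. riemann \<psi> x u v w)"
proof -
  note H = bilinear_ladd[OF bilinear_D2[OF \<psi>]] bilinear_radd[OF bilinear_D2[OF \<psi>]]
    bilinear_lmul[OF bilinear_D2[OF \<psi>]] bilinear_rmul[OF bilinear_D2[OF \<psi>]]
    matrix_vector_mult_add_rdistrib scaleR_matrix_vector_assoc[symmetric]
    matrix_vector_right_distrib matrix_vector_mult_scaleR inner_add_left inner_add_right
  show "bilinear (\<lambda>v w. riemann \<psi> x u v w)"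
    unfolding bilinear_def
    by (intro conjI allI linearI; rule vector_eq_rdot[THEN iffD1])
      (simp_all add: riemann_inner[OF \<psi>] H algebra_simps)
  show "linear (\<lambda>u. riemann \<psi> x u v w)"
    by (intro linearI; rule vector_eq_rdot[THEN iffD1])
      (simp_all add: riemann_inner[OF \<psi>] H algebra_simps)
qed

definition jac :: "(real^'n::finite \<Rightarrow> real^'n^'n) \<Rightarrow> real^'n \<Rightarrow> real^'n \<Rightarrow> real^'n \<Rightarrow> real^'n" where
  "jac \<psi> x a b = riemann \<psi> x b a a"

lemma linear_jac: "smooth_sym2_tensor \<psi> \<Longrightarrow> linear (jac \<psi> x a)"
  unfolding jac_def[abs_def] by (rule linear_riemann)

lemma jac_scale:
  assumes "smooth_sym2_tensor \<psi>"
  shows "jac \<psi> x (c *\<^sub>R a) b = c\<^sup>2 *\<^sub>R jac \<psi> x a b"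
  unfolding jac_def
  by (simp add: bilinear_lmul[OF bilinear_riemann[OF assms]] bilinear_rmul[OF bilinear_riemann[OF assms]]
      power2_eq_square)

lemma jac_self: "jac \<psi> x a a = 0"
  by (simp add: jac_def riemann_def)

lemma inner_matrix_commute:
  fixes M :: "real^'n::finite^'n"
  assumes "transpose M = M"
  shows "a \<bullet> (M *v b) = b \<bullet> (M *v a)"
  using dot_lmul_matrix[of a M b] transpose_matrix_vector[of M a] assms by (simp add: inner_commute)

lemma jac_symmetric:
  assumes \<psi>: "smooth_sym2_tensor \<psi>"
  shows "jac \<psi> x a b \<bullet> c = jac \<psi> x a c \<bullet> b"
proof -
  note m = inner_matrix_commute[OF transpose_D2[OF \<psi>]]
  show ?thesis
    unfolding jac_def riemann_inner[OF \<psi>]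
    using m[of c x b a a] m[of b x c a a] m[of c x a a b] D2_commute[OF \<psi>, of x]
    by (simp add: algebra_simps)
qed

lemma jacobi_g_psi:
  assumes "smooth_sym2_tensor \<psi>"
  shows "jacobi (g_psi \<psi>) z X = lower_block (jac \<psi> (xpart z) (xpart X))"
  by (simp add: fun_eq_iff jacobi_def curv_at_g_psi[OF assms] jac_def lower_block_def)

lemma lower_block_combination:
  "(\<Sum>e\<in>S. c e *\<^sub>R lower_block (C e) Y) = lower_block (\<lambda>b. \<Sum>e\<in>S. c e *\<^sub>R C e b) Y"
  by (simp only: lower_block_def linear_sum[OF linear_xy0] linear_cmul[OF linear_xy0])

lemma linear_combination_jac:
  assumes \<psi>: "smooth_sym2_tensor \<psi>"
  shows "linear (\<lambda>b. \<Sum>e\<in>S. c e *\<^sub>R jac \<psi> x (a e) b)"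
  by (intro linear_compose_sum ballI linear_compose_scale_right linear_jac[OF \<psi>])

lemma jacobi_sub_lower_block:
  assumes "smooth_sym2_tensor \<psi>"
  shows "\<exists>C. linear C \<and> jacobi_sub (g_psi \<psi>) z V = lower_block C"
proof -
  let ?B = "SOME B. orthonormal_basis (g_psi \<psi>) z V B"
  have "jacobi_sub (g_psi \<psi>) z V
      = lower_block (\<lambda>b. \<Sum>e\<in>?B. gprod (g_psi \<psi>) z e e *\<^sub>R jac \<psi> (xpart z) (xpart e) b)"
    by (simp add: fun_eq_iff jacobi_sub_def jacobi_g_psi[OF assms] lower_block_combination)
  with linear_combination_jac[OF assms] show ?thesis by (intro exI conjI)
qed

text \<open>All higher order Jacobi operators are strictly block-triangular, hence nilpotent.\<close>

theorem osserman_g_psi: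
  assumes "smooth_sym2_tensor \<psi>"
  shows "osserman (g_psi \<psi>) r s"
proof -
  have "eigenvalues (jacobi_sub (g_psi \<psi>) z V) = eigenvalues (jacobi_sub (g_psi \<psi>) z' V')" for z V z' V'
  proof -
    obtain C C' where "linear C" "jacobi_sub (g_psi \<psi>) z V = lower_block C"
      "linear C'" "jacobi_sub (g_psi \<psi>) z' V' = lower_block C'"
      using jacobi_sub_lower_block[OF assms] by blast
    then show ?thesis by (simp add: eigenvalues_def charpoly_lower_block)
  qed
  then show ?thesis unfolding osserman_def by blast
qed

lemma transpose_g_psi: "smooth_sym2_tensor \<psi> \<Longrightarrow> transpose (g_psi \<psi> z) = g_psi \<psi> z"
  using g_psi_pseudo_riemannian unfolding pseudo_riemannian_def by blast

text \<open>The nonzero block of \<open>J(\<pi>)\<close> when \<open>B\<close> is an orthonormal basis of \<open>\<pi>\<close>.\<close>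

definition signed_jac :: "(real^'n::finite \<Rightarrow> real^'n^'n) \<Rightarrow> real^('n + 'n) \<Rightarrow> (real^('n + 'n)) set \<Rightarrow> real^'n \<Rightarrow> real^'n" where
  "signed_jac \<psi> z B b = (\<Sum>e\<in>B. gprod (g_psi \<psi>) z e e *\<^sub>R jac \<psi> (xpart z) (xpart e) b)"

lemma linear_signed_jac: "smooth_sym2_tensor \<psi> \<Longrightarrow> linear (signed_jac \<psi> z B)"
  unfolding signed_jac_def[abs_def] by (rule linear_combination_jac)

lemma signed_jac_basis_independent:
  assumes \<psi>: "smooth_sym2_tensor \<psi>"
    and B: "orthonormal_basis (g_psi \<psi>) z V B" "orthonormal_basis (g_psi \<psi>) z V B'"
  shows "signed_jac \<psi> z B = signed_jac \<psi> z B'"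
proof
  fix b
  have "bilinear (\<lambda>u v. riemann \<psi> (xpart z) b (xpart u) (xpart v))"
    unfolding bilinear_def
    by (intro conjI allI linearI) (simp_all add: bilinear_ladd[OF bilinear_riemann[OF \<psi>]]
      bilinear_radd[OF bilinear_riemann[OF \<psi>]] bilinear_lmul[OF bilinear_riemann[OF \<psi>]]
      bilinear_rmul[OF bilinear_riemann[OF \<psi>]])
  from orthonormal_trace_independent[where g = "g_psi \<psi>" and x = z, OF transpose_g_psi[OF \<psi>] this B]
  show "signed_jac \<psi> z B b = signed_jac \<psi> z B' b"
    by (simp add: signed_jac_def jac_def)
qed

lemma jacobi_sub_g_psi:
  assumes \<psi>: "smooth_sym2_tensor \<psi>" and B: "orthonormal_basis (g_psi \<psi>) z V B"
  shows "jacobi_sub (g_psi \<psi>) z V = lower_block (signed_jac \<psi> z B)"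
proof -
  let ?B = "SOME B. orthonormal_basis (g_psi \<psi>) z V B"
  have "orthonormal_basis (g_psi \<psi>) z V ?B" using B by (rule someI)
  from signed_jac_basis_independent[OF \<psi> this B]
  have "lower_block (signed_jac \<psi> z ?B) = lower_block (signed_jac \<psi> z B)" by simp
  then show ?thesis
    by (simp add: fun_eq_iff jacobi_sub_def jacobi_g_psi[OF \<psi>] lower_block_combination signed_jac_def[abs_def])
qed

section \<open>Adapted orthonormal frames\<close>

lemma gprod_g_psi_parts:
  "gprod (g_psi \<psi>) z u v = xpart u \<bullet> (\<psi> (xpart z) *v xpart v) + xpart u \<bullet> ypart v + ypart u \<bullet> xpart v"
  by (simp add: gprod_g_psi inner_vec_def matrix_vector_mult_def sum_distrib_left mult.assoc)

text \<open>Unit vectors for \<open>s = 1\<close> (spacelike) and \<open>s = - 1\<close> (timelike); the \<open>y\<close>-part offsets what \<open>\<psi>\<close>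
  contributes to the inner products, so that the \<open>x\<close>-parts can be prescribed freely. The two vectors
  with the same index have the same \<open>x\<close>-part, so that their contributions to a higher order Jacobi operator cancel, while
  the scale of an unpaired vector can be chosen at will.\<close>

definition frame :: "(real^'n::finite \<Rightarrow> real^'n^'n) \<Rightarrow> real^('n + 'n) \<Rightarrow> ('n \<Rightarrow> real) \<Rightarrow> real \<Rightarrow> 'n \<Rightarrow> real^('n + 'n)" where
  "frame \<psi> z c s i = xy (c i *\<^sub>R axis i 1)
     ((s / (2 * c i)) *\<^sub>R axis i 1 - (c i / 2) *\<^sub>R (\<psi> (xpart z) *v axis i 1))"

lemma gprod_frame:
  assumes \<psi>: "smooth_sym2_tensor \<psi>" and c: "\<And>i. c i \<noteq> 0"
  shows "gprod (g_psi \<psi>) z (frame \<psi> z c s i) (frame \<psi> z c t j) = (if i = j then (s + t) / 2 else 0)"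
proof -
  have "transpose (\<psi> (xpart z)) = \<psi> (xpart z)" using \<psi> by (simp add: smooth_sym2_tensor_def)
  note m = inner_matrix_commute[OF this, of "axis j 1" "axis i 1"]
  show ?thesis
    using c[of i] c[of j]
    by (simp add: gprod_g_psi_parts frame_def matrix_vector_mult_scaleR inner_diff_left inner_diff_right
        inner_commute[of "\<psi> (xpart z) *v axis i 1"] m inner_axis_axis field_simps)
qed

definition frame_set where
  "frame_set \<psi> z c P N = frame \<psi> z c 1 ` P \<union> frame \<psi> z c (- 1) ` N"

lemma frame_set_orthonormal:
  assumes \<psi>: "smooth_sym2_tensor \<psi>" and c: "\<And>i. c i \<noteq> 0"
  shows "orthonormal_set (g_psi \<psi>) z (frame_set \<psi> z c P N)"
    and "inj (frame \<psi> z c s)" and "frame \<psi> z c 1 ` P \<inter> frame \<psi> z c (- 1) ` N = {}"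
    and "{e \<in> frame_set \<psi> z c P N. gprod (g_psi \<psi>) z e e < 0} = frame \<psi> z c (- 1) ` N"
    and "{e \<in> frame_set \<psi> z c P N. gprod (g_psi \<psi>) z e e > 0} = frame \<psi> z c 1 ` P"
proof -
  note gf = gprod_frame[where z = z and c = c, OF \<psi> c]
  show "orthonormal_set (g_psi \<psi>) z (frame_set \<psi> z c P N)"
    by (auto simp: orthonormal_set_def frame_set_def gf)
  show "inj (frame \<psi> z c s)"
  proof (rule injI)
    fix i j assume "frame \<psi> z c s i = frame \<psi> z c s j"
    then have "c i *\<^sub>R axis i 1 = c j *\<^sub>R axis j (1 :: real)" by (simp add: frame_def)
    then have "(c i *\<^sub>R axis i 1) $ i = (c j *\<^sub>R axis j (1 :: real)) $ i" by simp
    then show "i = j" using c[of i] by (auto simp: axis_def split: if_splits)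
  qed
  have "frame \<psi> z c 1 i \<noteq> frame \<psi> z c (- 1) j" for i j
    using gf[of 1 i 1 i] gf[of "- 1" j "- 1" j] by auto
  then show "frame \<psi> z c 1 ` P \<inter> frame \<psi> z c (- 1) ` N = {}" by blast
  show "{e \<in> frame_set \<psi> z c P N. gprod (g_psi \<psi>) z e e < 0} = frame \<psi> z c (- 1) ` N"
    "{e \<in> frame_set \<psi> z c P N. gprod (g_psi \<psi>) z e e > 0} = frame \<psi> z c 1 ` P"
    by (auto simp: frame_set_def gf)
qed

lemma frame_set_Gr:
  fixes \<psi> :: "real^'n::finite \<Rightarrow> real^'n^'n"
  assumes \<psi>: "smooth_sym2_tensor \<psi>" and c: "\<And>i. c i \<noteq> 0"
  shows "span (frame_set \<psi> z c P N) \<in> Gr (g_psi \<psi>) (card N) (card P) z"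
proof -
  note F = frame_set_orthonormal[where z = z and c = c, OF \<psi> c]
  have card: "card (frame \<psi> z c s ` S) = card S" for s S
    by (rule card_image) (rule inj_on_subset[OF F(2) subset_UNIV])
  have "nondegenerate_on (g_psi \<psi>) z (span (frame_set \<psi> z c P N))"
    unfolding nondegenerate_on_def
    using gprod_orthonormal_square(2)[where g = "g_psi \<psi>" and x = z, OF transpose_g_psi[OF \<psi>] F(1)] span_base
    by metis
  then show ?thesis
    unfolding Gr_def using F(1)[of P N] F(4,5)[of P N]
    by (auto intro!: exI[of _ "frame_set \<psi> z c P N"] simp: orthonormal_basis_iff card)
qed

lemma signed_jac_frame_set:
  fixes \<psi> :: "real^'n::finite \<Rightarrow> real^'n^'n"
  assumes \<psi>: "smooth_sym2_tensor \<psi>" and c: "\<And>i. c i \<noteq> 0"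
  shows "signed_jac \<psi> z (frame_set \<psi> z c P N) b =
    (\<Sum>i\<in>P. (c i)\<^sup>2 *\<^sub>R jac \<psi> (xpart z) (axis i 1) b) - (\<Sum>i\<in>N. (c i)\<^sup>2 *\<^sub>R jac \<psi> (xpart z) (axis i 1) b)"
proof -
  note F = frame_set_orthonormal[where z = z and c = c, OF \<psi> c]
  have x: "xpart (frame \<psi> z c s i) = c i *\<^sub>R axis i 1" for s i by (simp add: frame_def)
  have inj: "inj_on (frame \<psi> z c s) S" for s S by (rule inj_on_subset[OF F(2) subset_UNIV])
  show ?thesis
    unfolding signed_jac_def frame_set_def
    by (subst sum.union_disjoint)
      (simp_all add: F(3) sum.reindex[OF inj] gprod_frame[OF \<psi> c] x jac_scale[OF \<psi>] sum_negf)
qed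

text \<open>Ricci flatness: the frame with all spacelike and all timelike vectors is a basis in which
  everything cancels.\<close>

lemma signed_jac_full_basis:
  fixes \<psi> :: "real^'n::finite \<Rightarrow> real^'n^'n"
  assumes \<psi>: "smooth_sym2_tensor \<psi>" and B: "orthonormal_basis (g_psi \<psi>) z UNIV B"
  shows "signed_jac \<psi> z B b = 0"
proof -
  let ?F = "frame_set \<psi> z (\<lambda>_. 1) UNIV UNIV"
  note F = frame_set_orthonormal[where z = z and c = "\<lambda>_. 1", OF \<psi>, simplified]
  have "card ?F = CARD('n) + CARD('n)"
    unfolding frame_set_def by (subst card_Un_disjoint) (simp_all add: F(3) card_image[OF F(2)])
  then have "span ?F = UNIV"
    using dim_eq_full[of ?F] dim_eq_card_independent[OF orthonormal_set_independent[OF F(1)]] by simp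
  then have "orthonormal_basis (g_psi \<psi>) z UNIV ?F" using F(1) by (simp add: orthonormal_basis_iff)
  from signed_jac_basis_independent[OF \<psi> B this] show ?thesis
    using signed_jac_frame_set[OF \<psi>, of "\<lambda>_. 1"] by simp
qed

section \<open>Positive semi-definite operators\<close>

text \<open>Otherwise the form would be negative a little way from \<open>b\<close> in the direction \<open>- C b\<close>.\<close>

lemma psd_kernel:
  fixes C :: "'a::real_inner \<Rightarrow> 'a"
  assumes lin: "linear C" and sym: "\<And>u v. C u \<bullet> v = C v \<bullet> u"
    and psd: "\<And>v. 0 \<le> C v \<bullet> v" and b: "C b \<bullet> b = 0"
  shows "C b = 0"
proof (rule ccontr)
  assume "C b \<noteq> 0"
  define c where "c = C b"
  define m where "m = c \<bullet> c"
  define q where "q = C c \<bullet> c"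
  have m: "m > 0" using \<open>C b \<noteq> 0\<close> by (simp add: m_def c_def)
  have q: "q \<ge> 0" using psd by (simp add: q_def)
  (* small enough that the quadratic term t^2 q does not outweigh the linear term 2 t m *)
  define t where "t = - m / (q + 1)"
  have "C (b + t *\<^sub>R c) \<bullet> (b + t *\<^sub>R c) = t * (2 * m + t * q)"
    using sym[of c b] b
    by (simp add: linear_add[OF lin] linear_cmul[OF lin] inner_add_left inner_add_right m_def q_def
        c_def[symmetric] algebra_simps)
  moreover have "2 * m + t * q > 0"
  proof -
    have "- (t * q) = m * (q / (q + 1))" by (simp add: t_def)
    also have "\<dots> \<le> m * 1" using m q by (intro mult_left_mono) (simp_all add: divide_simps)
    finally show ?thesis using m by linarith
  qed
  moreover have "t < 0" using m q by (simp add: t_def divide_neg_pos)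
  ultimately have "C (b + t *\<^sub>R c) \<bullet> (b + t *\<^sub>R c) < 0" by (simp add: mult_neg_pos)
  then show False using psd[of "b + t *\<^sub>R c"] by linarith
qed

text \<open>Maximizing the Rayleigh quotient of \<open>Q\<close> relative to \<open>P\<close> finds the first parameter at which the
  pencil \<open>P - \<mu> Q\<close> degenerates; at half of it the pencil is still definite.\<close>

lemma definite_pencil:
  fixes P Q :: "'a::euclidean_space \<Rightarrow> 'a"
  assumes P: "linear P" "\<And>u v. P u \<bullet> v = P v \<bullet> u" "\<And>v. v \<noteq> 0 \<Longrightarrow> 0 < P v \<bullet> v"
    and Q: "linear Q" "\<And>u v. Q u \<bullet> v = Q v \<bullet> u" "\<And>v. 0 \<le> Q v \<bullet> v" and w: "0 < Q w \<bullet> w"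
  obtains \<mu> \<mu>' v where "0 < \<mu>" "0 < \<mu>'" "v \<noteq> 0" "P v = \<mu> *\<^sub>R Q v"
    "\<And>v. P v = \<mu>' *\<^sub>R Q v \<Longrightarrow> v = 0"
proof -
  define f where "f v = (Q v \<bullet> v) / (P v \<bullet> v)" for v
  have w0: "w \<noteq> 0" using w by auto
  have f_scale: "f (k *\<^sub>R v) = f v" if "k \<noteq> 0" for k v
    using that by (simp add: f_def linear_cmul[OF P(1)] linear_cmul[OF Q(1)])
  have Pnz: "P v \<bullet> v \<noteq> 0" if "v \<in> sphere 0 1" for v
  proof -
    have "v \<noteq> 0" using that by auto
    then show ?thesis using P(3) by force
  qed
  have "continuous_on (sphere 0 1) f"
    unfolding f_def using Pnz linear_continuous_on P(1) Q(1) linear_conv_bounded_linear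
    by (intro continuous_intros) blast+
  moreover have "sgn w \<in> sphere 0 1" using w0 by (simp add: norm_sgn)
  ultimately obtain v where v: "v \<in> sphere 0 1" "\<And>y. y \<in> sphere 0 1 \<Longrightarrow> f y \<le> f v"
    using continuous_attains_sup[of "sphere 0 1" f] by (metis compact_sphere empty_iff)
  have v0: "v \<noteq> 0" using v(1) by auto
  define M where "M = f v"
  have fM: "f y \<le> M" if "y \<noteq> 0" for y
  proof -
    have "f (sgn y) \<le> M" using that v(2) by (simp add: M_def norm_sgn)
    then show ?thesis using f_scale[of "inverse (norm y)" y] that by (simp add: sgn_div_norm)
  qed
  have QP: "Q y \<bullet> y \<le> M * (P y \<bullet> y)" for y
  proof (cases "y = 0")
    case False
    then show ?thesis using fM[OF False] P(3)[OF False] by (simp add: f_def divide_simps)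
  qed (simp add: linear_0[OF Q(1)])
  have "0 < f w" using w P(3)[OF w0] by (simp add: f_def)
  then have M: "0 < M" using fM[OF w0] by linarith
  have "M *\<^sub>R P v - Q v = 0"
  proof (rule psd_kernel[of "\<lambda>y. M *\<^sub>R P y - Q y"])
    show "linear (\<lambda>y. M *\<^sub>R P y - Q y)"
      by (intro linear_compose_sub linear_compose_scale_right P(1) Q(1))
    show "(M *\<^sub>R P u - Q u) \<bullet> v = (M *\<^sub>R P v - Q v) \<bullet> u" for u v
      by (simp add: inner_diff_left P(2)[of u v] Q(2)[of u v])
    show "0 \<le> (M *\<^sub>R P y - Q y) \<bullet> y" for y using QP[of y] by (simp add: inner_diff_left)
    show "(M *\<^sub>R P v - Q v) \<bullet> v = 0"
      using P(3)[OF v0] by (simp add: inner_diff_left M_def f_def)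
  qed
  then have "(1 / M) *\<^sub>R (M *\<^sub>R P v) = (1 / M) *\<^sub>R Q v" by simp
  then have 1: "P v = (1 / M) *\<^sub>R Q v" using M by simp
  have 2: "y = 0" if y: "P y = (1 / (2 * M)) *\<^sub>R Q y" for y
  proof (rule ccontr)
    assume "y \<noteq> 0"
    have "P y \<bullet> y = (1 / (2 * M)) * (Q y \<bullet> y)" using y by simp
    also have "\<dots> \<le> (1 / (2 * M)) * (M * (P y \<bullet> y))" using QP M by (intro mult_left_mono) auto
    also have "\<dots> = (P y \<bullet> y) / 2" using M by simp
    finally show False using P(3)[OF \<open>y \<noteq> 0\<close>] by linarith
  qed
  show ?thesis by (rule that[of "1 / M" "1 / (2 * M)" v]) (use M v0 1 2 in auto)
qed

lemma dim_range_scale: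
  fixes C :: "'a::euclidean_space \<Rightarrow> 'b::euclidean_space"
  assumes C: "linear C" and k: "k \<noteq> 0"
  shows "dim (range (\<lambda>b. k *\<^sub>R C b)) = dim (range C)"
proof -
  have "C b \<in> range (\<lambda>b. k *\<^sub>R C b)" for b
    using k by (intro image_eqI[of _ _ "inverse k *\<^sub>R b"]) (simp_all add: linear_cmul[OF C])
  moreover have "k *\<^sub>R C b \<in> range C" for b
    using linear_cmul[OF C] by (metis rangeI)
  ultimately have "range (\<lambda>b. k *\<^sub>R C b) = range C" by blast
  then show ?thesis by simp
qed

section \<open>The Jacobi operators for \<open>\<psi> \<in> \<Psi>\<close>\<close>

lemma Psi_smooth: "\<psi> \<in> Psi \<Longrightarrow> smooth_sym2_tensor \<psi>"
  by (simp add: Psi_def)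

text \<open>The condition that defines \<open>\<Psi>\<close>, read off at the point \<open>(x,0)\<close> for the vector \<open>(a,0)\<close>.\<close>

lemma Psi_jac:
  fixes \<psi> :: "real^'n::finite \<Rightarrow> real^'n^'n"
  assumes "\<psi> \<in> Psi" and "a \<noteq> 0"
  shows "0 \<le> jac \<psi> x a b \<bullet> b" and "dim (range (jac \<psi> x a)) = CARD('n) - 1"
proof -
  note \<psi> = Psi_smooth[OF assms(1)]
  have "xy a 0 = (\<Sum>i\<in>UNIV. a $ i *\<^sub>R axis (Inl i) 1)"
    by (rule vec_plus_eqI) (simp_all add: axis_def if_distrib cong: if_cong)
  also have "\<dots> \<in> X_space" unfolding X_space_def by (intro span_sum span_scale span_base) simp
  finally have X: "xy a 0 \<in> X_space" .
  have nz: "xy a 0 \<noteq> 0" using assms(2) by (metis xy_0 xy_eq_iff)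
  have J: "jacobi (g_psi \<psi>) (xy x 0) (xy a 0) = lower_block (jac \<psi> x a)"
    by (simp add: jacobi_g_psi[OF \<psi>])
  have "pos_semidef (g_psi \<psi>) (xy x 0) (lower_block (jac \<psi> x a)) \<and>
      dim (range (lower_block (jac \<psi> x a))) = CARD('n) - 1"
    using assms(1) X nz unfolding Psi_def J[symmetric] by blast
  then have ps: "0 \<le> gprod (g_psi \<psi>) (xy x 0) (lower_block (jac \<psi> x a) (xy b 0)) (xy b 0)"
    and dm: "dim (range (lower_block (jac \<psi> x a))) = CARD('n) - 1"
    unfolding pos_semidef_def by blast+
  show "0 \<le> jac \<psi> x a b \<bullet> b" using ps by (simp add: gprod_g_psi_parts lower_block_def)
  show "dim (range (jac \<psi> x a)) = CARD('n) - 1"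
    using dm by (simp add: dim_range_lower_block linear_jac[OF \<psi>])
qed

lemma Psi_jac_nonneg:
  assumes "\<psi> \<in> Psi"
  shows "0 \<le> jac \<psi> x a b \<bullet> b"
proof (cases "a = 0")
  case True
  then show ?thesis using jac_scale[OF Psi_smooth[OF assms], of x 0 0 b] by simp
qed (rule Psi_jac[OF assms])

text \<open>The range of the symmetric operator \<open>J(a)\<close> is orthogonal to its kernel, which contains \<open>a\<close>.
  A kernel vector outside the line of \<open>a\<close> would make the rank at most \<open>p - 2\<close>.\<close>

lemma Psi_jac_definite:
  fixes \<psi> :: "real^'n::finite \<Rightarrow> real^'n^'n"
  assumes \<psi>: "\<psi> \<in> Psi" and a: "a \<noteq> 0" and b: "jac \<psi> x a b \<bullet> b = 0"
  shows "b \<in> span {a}"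
proof (rule ccontr)
  assume nb: "b \<notin> span {a}"
  note sm = Psi_smooth[OF \<psi>]
  have b0: "jac \<psi> x a b = 0"
    by (rule psd_kernel[OF linear_jac[OF sm] jac_symmetric[OF sm] Psi_jac_nonneg[OF \<psi>] b])
  have ind: "independent {b, a}" using a nb by (simp add: independent_insert)
  have "b \<noteq> a" using nb span_base[of a "{a}"] by auto
  then have d2: "dim {b, a} = 2" using dim_eq_card_independent[OF ind] by simp
  have "range (jac \<psi> x a) \<subseteq> {y \<in> UNIV. \<forall>u\<in>span {b, a}. orthogonal u y}"
  proof (rule image_subsetI)
    fix c
    have "orthogonal u (jac \<psi> x a c)" if "u \<in> span {b, a}" for u
    proof -
      have "jac \<psi> x a u = 0" using that
      proof (induction rule: span_induct_alt)
        case base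
        then show ?case by (rule linear_0[OF linear_jac[OF sm]])
      next
        case (step k u v)
        then show ?case
          using b0 jac_self[of \<psi> x a]
          by (auto simp: linear_add[OF linear_jac[OF sm]] linear_cmul[OF linear_jac[OF sm]])
      qed
      then show ?thesis
        using jac_symmetric[OF sm, of x a c u] by (simp add: orthogonal_def inner_commute)
    qed
    then show "jac \<psi> x a c \<in> {y \<in> UNIV. \<forall>u\<in>span {b, a}. orthogonal u y}" by blast
  qed
  then have "dim (range (jac \<psi> x a)) \<le> dim {y \<in> UNIV. \<forall>u\<in>span {b, a}. orthogonal u y}"
    by (rule dim_subset)
  moreover have "dim {y \<in> UNIV. \<forall>u\<in>span {b, a}. orthogonal u y} + dim (span {b, a})
      = dim (UNIV :: (real^'n) set)"
    by (rule dim_subspace_orthogonal_to_vectors) simp_all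
  ultimately show False using Psi_jac(2)[OF \<psi> a, of x] d2 by simp
qed

lemma Psi_sum_jac_pos:
  assumes \<psi>: "\<psi> \<in> Psi" and S: "finite S" "e \<in> S" "f \<in> S"
    and ef: "v e \<noteq> 0" "v f \<noteq> 0" "span {v e} \<inter> span {v f} \<subseteq> {0}" and b: "b \<noteq> 0"
  shows "0 < (\<Sum>i\<in>S. jac \<psi> x (v i) b) \<bullet> b"
proof -
  have "b \<notin> span {v e} \<or> b \<notin> span {v f}" using ef(3) b by blast
  then obtain k where k: "k \<in> S" "v k \<noteq> 0" "b \<notin> span {v k}" using S ef by blast
  have "0 < jac \<psi> x (v k) b \<bullet> b"
    using Psi_jac_definite[OF \<psi> k(2), of x b] Psi_jac_nonneg[OF \<psi>, of x "v k" b] k(3) by force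
  then have "0 < (\<Sum>i\<in>S. jac \<psi> x (v i) b \<bullet> b)"
    using S(1) k(1) Psi_jac_nonneg[OF \<psi>] by (intro sum_pos2)
  then show ?thesis by (simp add: inner_sum_left)
qed

section \<open>Definite subspaces and their complements\<close>

text \<open>A definite subspace meets the totally isotropic space of the \<open>y\<close>-directions trivially, so that
  the \<open>x\<close>-parts of an orthonormal basis stay independent.\<close>

lemma definite_xpart_inj:
  fixes \<psi> :: "real^'n::finite \<Rightarrow> real^'n^'n"
  assumes \<psi>: "smooth_sym2_tensor \<psi>" and T: "orthonormal_set (g_psi \<psi>) z T"
    and def: "\<And>e. e \<in> T \<Longrightarrow> gprod (g_psi \<psi>) z e e = \<sigma>" and \<sigma>: "\<sigma> \<noteq> 0"
    and u: "u \<in> span T" "xpart u = 0"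
  shows "u = 0"
proof (rule ccontr)
  assume nz: "u \<noteq> 0"
  let ?g = "gprod (g_psi \<psi>) z"
  note sq = gprod_orthonormal_square[where g = "g_psi \<psi>" and x = z, OF transpose_g_psi[OF \<psi>] T u(1)]
  obtain e where e: "e \<in> T" "?g u e \<noteq> 0" using sq(2)[OF nz] by blast
  have "0 = ?g u u" using u(2) by (simp add: gprod_g_psi_parts)
  also have "\<dots> = \<sigma> * (\<Sum>e\<in>T. (?g u e)\<^sup>2)"
    unfolding sq(1) sum_distrib_left by (rule sum.cong) (simp_all add: def)
  finally have "(\<Sum>e\<in>T. (?g u e)\<^sup>2) = 0" using \<sigma> by simp
  then show False
    using e T sum_nonneg_eq_0_iff[of T "\<lambda>e. (?g u e)\<^sup>2"] by (auto simp: orthonormal_set_def)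
qed

text \<open>The kernel of a sum of positive semi-definite operators is the intersection of their kernels.
  Here these are the lines of the \<open>x\<close>-parts, and two of them already meet in \<open>0\<close>.\<close>

lemma definite_signed_jac_rank:
  fixes \<psi> :: "real^'n::finite \<Rightarrow> real^'n^'n"
  assumes \<psi>: "\<psi> \<in> Psi" and T: "orthonormal_set (g_psi \<psi>) z T" "T \<noteq> {}"
    and def: "\<And>e. e \<in> T \<Longrightarrow> gprod (g_psi \<psi>) z e e = \<sigma>"
  shows "dim (range (signed_jac \<psi> z T)) = (if card T = 1 then CARD('n) - 1 else CARD('n))"
proof -
  note sm = Psi_smooth[OF \<psi>]
  let ?g = "gprod (g_psi \<psi>) z"
  have fin: "finite T" using T(1) by (simp add: orthonormal_set_def)
  have \<sigma>: "\<sigma> \<noteq> 0" using T def by (fastforce simp: orthonormal_set_def)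
  note inj = definite_xpart_inj[OF sm T(1) def \<sigma>]
  have x0: "xpart e \<noteq> 0" if "e \<in> T" for e
  proof
    assume "xpart e = 0"
    then have "e = 0" using inj[of e] span_base[OF that] by blast
    then show False using def[OF that] \<sigma> by (simp add: gprod_simps)
  qed
  have sj: "signed_jac \<psi> z T b = \<sigma> *\<^sub>R (\<Sum>e\<in>T. jac \<psi> (xpart z) (xpart e) b)" for b
    unfolding signed_jac_def scaleR_sum_right by (rule sum.cong) (simp_all add: def)
  show ?thesis
  proof (cases "card T = 1")
    case True
    then obtain e where e: "T = {e}" using card_1_singletonE by blast
    have "signed_jac \<psi> z T = (\<lambda>b. \<sigma> *\<^sub>R jac \<psi> (xpart z) (xpart e) b)" unfolding fun_eq_iff sj by (simp add: e)
    then show ?thesis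
      using dim_range_scale[OF linear_jac[OF sm] \<sigma>] Psi_jac(2)[OF \<psi> x0[of e]] True e by simp
  next
    case False
    then have "card T \<ge> 2" using T(2) fin by (metis One_nat_def Suc_1 Suc_leI card_gt_0_iff nat_less_le)
    then obtain e f where ef: "e \<in> T" "f \<in> T" "e \<noteq> f"
      by (metis card_le_Suc0_iff_eq fin not_less_eq_eq numeral_2_eq_2)
    have "span {xpart e} \<inter> span {xpart f} \<subseteq> {0}"
    proof
      fix y assume "y \<in> span {xpart e} \<inter> span {xpart f}"
      then obtain k l where kl: "y = k *\<^sub>R xpart e" "y = l *\<^sub>R xpart f"
        unfolding span_singleton by blast
      have "k *\<^sub>R e - l *\<^sub>R f \<in> span T" using ef by (intro span_diff span_scale span_base)
      moreover have "xpart (k *\<^sub>R e - l *\<^sub>R f) = 0" using kl by simp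
      ultimately have "k *\<^sub>R e - l *\<^sub>R f = 0" using inj by blast
      then have "?g (k *\<^sub>R e - l *\<^sub>R f) e = 0" by (simp add: gprod_simps)
      moreover have "?g f e = 0" using ef T(1) by (auto simp: orthonormal_set_def)
      ultimately have "k = 0" using def[OF ef(1)] \<sigma> by (simp add: gprod_simps)
      then show "y \<in> {0}" using kl by simp
    qed
    from Psi_sum_jac_pos[OF \<psi> fin ef(1,2), of xpart, OF x0[OF ef(1)] x0[OF ef(2)] this]
    have "0 < (\<Sum>i\<in>T. jac \<psi> (xpart z) (xpart i) b) \<bullet> b" if "b \<noteq> 0" for b using that by blast
    then have "\<forall>b. signed_jac \<psi> z T b = 0 \<longrightarrow> b = 0" using \<sigma> by (fastforce simp: sj)
    then show ?thesis using dim_range_full_iff[OF linear_signed_jac[OF sm]] False by simp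
  qed
qed

lemma orthonormal_set_definite:
  assumes T: "orthonormal_set g x T"
    and n: "card {e\<in>T. gprod g x e e < 0} = r" "card {e\<in>T. gprod g x e e > 0} = s"
    and rs: "r = 0 \<or> s = 0"
  obtains \<sigma> where "\<And>e. e \<in> T \<Longrightarrow> gprod g x e e = \<sigma>" "card T = r + s"
proof -
  have fin: "finite T" and pm: "\<And>e. e \<in> T \<Longrightarrow> gprod g x e e = 1 \<or> gprod g x e e = - 1"
    using T by (simp_all add: orthonormal_set_def)
  from rs show ?thesis
  proof
    assume "r = 0"
    then have "{e\<in>T. gprod g x e e < 0} = {}" using n(1) fin by simp
    then have 1: "gprod g x e e = 1" if "e \<in> T" for e using pm[OF that] that by auto
    then have "{e\<in>T. gprod g x e e > 0} = T" by auto
    then show ?thesis using that[of 1] 1 n(2) \<open>r = 0\<close> by simp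
  next
    assume "s = 0"
    then have "{e\<in>T. gprod g x e e > 0} = {}" using n(2) fin by simp
    then have 1: "gprod g x e e = - 1" if "e \<in> T" for e using pm[OF that] that by auto
    then have "{e\<in>T. gprod g x e e < 0} = T" by auto
    then show ?thesis using that[of "- 1"] 1 n(1) \<open>s = 0\<close> by simp
  qed
qed

text \<open>A subspace that contains a maximal definite subspace has a definite orthogonal complement,
  and by Ricci flatness its Jacobi operator is the negative of that of the complement. The number
  \<open>k\<close> is the dimension of whichever of the two is definite.\<close>

lemma jacobi_sub_rank:
  fixes \<psi> :: "real^'n::finite \<Rightarrow> real^'n^'n"
  assumes \<psi>: "\<psi> \<in> Psi" and V: "V \<in> Gr (g_psi \<psi>) r s z"
    and type: "(r = 0 \<or> s = 0) \<and> k = r + s \<or>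
      (r = CARD('n) \<and> k = CARD('n) - s \<or> s = CARD('n) \<and> k = CARD('n) - r)" and k: "0 < k"
  obtains C where "linear C" "jacobi_sub (g_psi \<psi>) z V = lower_block C"
    "dim (range C) = (if k = 1 then CARD('n) - 1 else CARD('n))"
proof -
  note sm = Psi_smooth[OF \<psi>]
  obtain B where B: "orthonormal_basis (g_psi \<psi>) z V B"
    and n: "card {e\<in>B. gprod (g_psi \<psi>) z e e < 0} = r" "card {e\<in>B. gprod (g_psi \<psi>) z e e > 0} = s"
    using V unfolding Gr_def by blast
  have oB: "orthonormal_set (g_psi \<psi>) z B" using B by (simp add: orthonormal_basis_iff)
  have "dim (range (signed_jac \<psi> z B)) = (if k = 1 then CARD('n) - 1 else CARD('n))"
  proof (cases "(r = 0 \<or> s = 0) \<and> k = r + s")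
    case True
    obtain \<sigma> where \<sigma>: "\<And>e. e \<in> B \<Longrightarrow> gprod (g_psi \<psi>) z e e = \<sigma>" "card B = r + s"
      using orthonormal_set_definite[OF oB n] True by blast
    then have "B \<noteq> {}" using True k by auto
    from definite_signed_jac_rank[OF \<psi> oB this \<sigma>(1)] show ?thesis using \<sigma>(2) True by simp
  next
    case False
    have U: "UNIV \<in> Gr (g_psi \<psi>) CARD('n) CARD('n) z"
      using g_psi_pseudo_riemannian[OF sm] unfolding pseudo_riemannian_def by blast
    obtain T where T: "B \<inter> T = {}" "orthonormal_basis (g_psi \<psi>) z UNIV (B \<union> T)"
      "card {e\<in>T. gprod (g_psi \<psi>) z e e < 0} = CARD('n) - r"
      "card {e\<in>T. gprod (g_psi \<psi>) z e e > 0} = CARD('n) - s"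
      using orthonormal_complement[where g = "g_psi \<psi>" and x = z, OF transpose_g_psi[OF sm] U oB n] .
    have oT: "orthonormal_set (g_psi \<psi>) z T"
      using T(2) orthonormal_set_subset[of _ z "B \<union> T" T] by (simp add: orthonormal_basis_iff)
    have k': "k = (CARD('n) - r) + (CARD('n) - s)" "CARD('n) - r = 0 \<or> CARD('n) - s = 0"
      using False type by auto
    obtain \<sigma> where \<sigma>: "\<And>e. e \<in> T \<Longrightarrow> gprod (g_psi \<psi>) z e e = \<sigma>" "card T = k"
      using orthonormal_set_definite[OF oT T(3,4) k'(2)] k'(1) by metis
    then have "T \<noteq> {}" using k by auto
    from definite_signed_jac_rank[OF \<psi> oT this \<sigma>(1)]
    have rT: "dim (range (signed_jac \<psi> z T)) = (if k = 1 then CARD('n) - 1 else CARD('n))"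
      using \<sigma>(2) by simp
    have "signed_jac \<psi> z B b + signed_jac \<psi> z T b = 0" for b
      using signed_jac_full_basis[OF sm T(2), of b] T(1) oB oT
      by (simp add: signed_jac_def sum.union_disjoint orthonormal_set_def)
    then have "signed_jac \<psi> z B = (\<lambda>b. (- 1) *\<^sub>R signed_jac \<psi> z T b)"
      by (simp add: fun_eq_iff eq_neg_iff_add_eq_0)
    then show ?thesis using rT dim_range_scale[OF linear_signed_jac[OF sm], of "- 1"] by simp
  qed
  then show ?thesis using that linear_signed_jac[OF sm] jacobi_sub_g_psi[OF sm B] by blast
qed

lemma jordan_osserman_definite:
  fixes \<psi> :: "real^'n::finite \<Rightarrow> real^'n^'n"
  assumes \<psi>: "\<psi> \<in> Psi"
    and type: "(r = 0 \<or> s = 0) \<and> k = r + s \<or>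
      (r = CARD('n) \<and> k = CARD('n) - s \<or> s = CARD('n) \<and> k = CARD('n) - r)" and k: "0 < k"
  shows "jordan_osserman (g_psi \<psi>) r s"
  unfolding jordan_osserman_def
proof (intro allI ballI)
  fix z w V W
  assume V: "V \<in> Gr (g_psi \<psi>) r s z" and W: "W \<in> Gr (g_psi \<psi>) r s w"
  obtain C where "linear C" "jacobi_sub (g_psi \<psi>) z V = lower_block C"
    "dim (range C) = (if k = 1 then CARD('n) - 1 else CARD('n))"
    using jacobi_sub_rank[OF \<psi> V type k] .
  moreover obtain C' where "linear C'" "jacobi_sub (g_psi \<psi>) w W = lower_block C'"
    "dim (range C') = (if k = 1 then CARD('n) - 1 else CARD('n))"
    using jacobi_sub_rank[OF \<psi> W type k] .
  ultimately show "conjugate (jacobi_sub (g_psi \<psi>) z V) (jacobi_sub (g_psi \<psi>) w W)"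
    by (simp add: conjugate_lower_block_iff)
qed

section \<open>Mixed signature\<close>

text \<open>The block of \<open>J(\<pi>)\<close> for the span \<open>\<pi>\<close> of the frame vectors with spacelike indices \<open>P\<close> and timelike
  indices \<open>N\<close>.\<close>

definition jac_diff :: "(real^'n::finite \<Rightarrow> real^'n^'n) \<Rightarrow> real^'n \<Rightarrow> ('n \<Rightarrow> real) \<Rightarrow> 'n set \<Rightarrow> 'n set \<Rightarrow> real^'n \<Rightarrow> real^'n" where
  "jac_diff \<psi> x c P N b =
     (\<Sum>i\<in>P. (c i)\<^sup>2 *\<^sub>R jac \<psi> x (axis i 1) b) - (\<Sum>i\<in>N. (c i)\<^sup>2 *\<^sub>R jac \<psi> x (axis i 1) b)"

lemma linear_jac_diff: "smooth_sym2_tensor \<psi> \<Longrightarrow> linear (jac_diff \<psi> x c P N)"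
  unfolding jac_diff_def[abs_def] by (intro linear_compose_sub linear_combination_jac)

lemma jac_diff_cancel:
  fixes c :: "'n::finite \<Rightarrow> real"
  shows "jac_diff \<psi> x c P N = jac_diff \<psi> x c (P - N) (N - P)"
proof -
  have "sum h P = sum h (P - N) + sum h (P \<inter> N)" "sum h N = sum h (N - P) + sum h (P \<inter> N)"
    for h :: "'n \<Rightarrow> real^'n"
    using sum.Int_Diff[of P h N] sum.Int_Diff[of N h P] by (simp_all add: Int_commute add.commute)
  then show ?thesis by (simp add: jac_diff_def fun_eq_iff)
qed

lemma axis_span_disjoint:
  fixes i j :: "'n::finite"
  assumes "i \<noteq> j"
  shows "span {axis i (1::real)} \<inter> span {axis j 1} \<subseteq> {0}"
proof
  fix y :: "real^'n" assume "y \<in> span {axis i 1} \<inter> span {axis j 1}"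
  then obtain k l where kl: "y = k *\<^sub>R axis i 1" "y = l *\<^sub>R axis j 1" unfolding span_singleton by blast
  have "y $ a = 0" for a
  proof (cases "a = i")
    case True
    then show ?thesis unfolding kl(2) using assms by (simp add: axis_def)
  next
    case False
    then show ?thesis unfolding kl(1) by (simp add: axis_def)
  qed
  then show "y \<in> {0}" by (simp add: vec_eq_iff)
qed

lemma Psi_jac_axis_pos:
  fixes i j :: "'n::finite"
  assumes \<psi>: "\<psi> \<in> Psi" and ij: "i \<noteq> j"
  shows "0 < jac \<psi> x (axis i 1) (axis j 1) \<bullet> axis j 1"
proof -
  have "axis i (1::real) \<noteq> 0" "axis j (1::real) \<noteq> 0" by (simp_all add: axis_eq_0_iff)
  moreover have "axis j (1::real) \<notin> span {axis i 1}"
    using axis_span_disjoint[OF ij] span_base[of "axis j (1::real)" "{axis j 1}"] calculation(2) by blast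
  ultimately show ?thesis
    using Psi_jac_definite[OF \<psi>, of "axis i 1" x "axis j 1"] Psi_jac_nonneg[OF \<psi>, of x "axis i 1" "axis j 1"]
    by force
qed

text \<open>With equal index sets everything cancels. If they differ in one index each, what remains is a
  difference of two Jacobi operators with different kernels.\<close>

lemma jac_diff_two_ranks_balanced:
  fixes \<psi> :: "real^'n::finite \<Rightarrow> real^'n^'n"
  assumes \<psi>: "\<psi> \<in> Psi" and l: "0 < l" "l < CARD('n)"
  obtains P N where "card P = l" "card N = l"
    "dim (range (jac_diff \<psi> x (\<lambda>_. 1) P N)) \<noteq> dim (range (jac_diff \<psi> x (\<lambda>_. 1) N N))"
proof -
  obtain N :: "'n set" where N: "card N = l" using ex_card[of l "UNIV :: 'n set"] l by auto
  obtain b where b: "b \<in> N" using N l(1) by fastforce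
  obtain a where a: "a \<notin> N" using N l(2) by (metis UNIV_eq_I less_irrefl)
  define P where "P = insert a (N - {b})"
  have P: "card P = l" using a b N l(1) by (simp add: P_def card_Diff_singleton)
  have "P - N = {a}" "N - P = {b}" using a b by (auto simp: P_def)
  then have "jac_diff \<psi> x (\<lambda>_. 1) P N (axis b 1) = jac \<psi> x (axis a 1) (axis b 1)"
    unfolding jac_diff_cancel[of \<psi> x _ P N] by (simp add: jac_diff_def jac_self)
  then have "jac_diff \<psi> x (\<lambda>_. 1) P N (axis b 1) \<noteq> 0"
    using Psi_jac_axis_pos[OF \<psi>, of a b x] a b by force
  then have nz: "dim (range (jac_diff \<psi> x (\<lambda>_. 1) P N)) \<noteq> 0" by auto
  have z: "dim (range (jac_diff \<psi> x (\<lambda>_. 1) N N)) = 0" by (auto simp: jac_diff_def)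
  show ?thesis by (rule that[OF P N]) (use nz z in metis)
qed

text \<open>After cancellation there remain a sum \<open>A\<close> of at least two Jacobi operators, which is positive
  definite, and one operator \<open>Q\<close> with the opposite sign and a free scale \<open>\<mu>\<close>. The pencil \<open>A - \<mu> Q\<close>
  is singular for one \<open>\<mu>\<close> and regular for another.\<close>

lemma jac_diff_two_ranks_unbalanced:
  fixes \<psi> :: "real^'n::finite \<Rightarrow> real^'n^'n"
  assumes \<psi>: "\<psi> \<in> Psi" and kl: "0 < k" "k < l" "l < CARD('n)"
  obtains P N c c' where "card P = l" "card N = k" "\<forall>i. c i \<noteq> 0" "\<forall>i. c' i \<noteq> 0"
    "dim (range (jac_diff \<psi> x c P N)) \<noteq> dim (range (jac_diff \<psi> x c' P N))"
proof -
  note sm = Psi_smooth[OF \<psi>]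
  obtain P :: "'n set" where P: "card P = l" using ex_card[of l "UNIV :: 'n set"] kl by auto
  have "k - 1 \<le> card P" using P kl by simp
  then obtain N0 where N0: "N0 \<subseteq> P" "card N0 = k - 1" using ex_card by blast
  (* k - 1 timelike vectors cancel against spacelike ones; the last one is put over a new index *)
  obtain b where b: "b \<notin> P" using P kl(3) by (metis UNIV_eq_I less_irrefl)
  define N where "N = insert b N0"
  have N: "card N = k" using b N0 kl(1) by (auto simp: N_def card_insert_if)
  define S where "S = P - N0"
  have PN: "P - N = S" "N - P = {b}" "b \<notin> S" using b N0 by (auto simp: N_def S_def)
  have "card S = l - (k - 1)" using P N0 by (simp add: S_def card_Diff_subset)
  then have "\<not> card S \<le> Suc 0" using kl by simp
  then obtain e f where ef: "e \<in> S" "f \<in> S" "e \<noteq> f" by (metis card_le_Suc0_iff_eq finite)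
  define A where "A v = (\<Sum>i\<in>S. jac \<psi> x (axis i 1) v)" for v
  define Q where "Q = jac \<psi> x (axis b 1)"
  have linA: "linear A" unfolding A_def[abs_def] by (intro linear_compose_sum ballI linear_jac[OF sm])
  have symA: "A u \<bullet> v = A v \<bullet> u" for u v
    unfolding A_def inner_sum_left by (intro sum.cong refl jac_symmetric[OF sm])
  have posA: "0 < A v \<bullet> v" if "v \<noteq> 0" for v
    unfolding A_def using Psi_sum_jac_pos[OF \<psi>, of S e f "\<lambda>i. axis i 1", OF finite ef(1,2)]
      axis_span_disjoint[OF ef(3)] that by (simp add: axis_eq_0_iff)
  have "e \<noteq> b" using ef(1) PN(3) by auto
  then have w: "0 < Q (axis e 1) \<bullet> axis e 1" unfolding Q_def using Psi_jac_axis_pos[OF \<psi>] by metis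
  obtain \<mu> \<mu>' v where \<mu>: "0 < \<mu>" "0 < \<mu>'" "v \<noteq> 0" "A v = \<mu> *\<^sub>R Q v"
    "\<And>v. A v = \<mu>' *\<^sub>R Q v \<Longrightarrow> v = 0"
    using definite_pencil[of A Q "axis e 1", OF linA symA posA _ _ _ w] linear_jac[OF sm]
      jac_symmetric[OF sm] Psi_jac_nonneg[OF \<psi>] unfolding Q_def by metis
  define c where "c \<mu> i = (if i = b then sqrt \<mu> else 1)" for \<mu> i
  have D: "jac_diff \<psi> x (c \<mu>) P N v = A v - \<mu> *\<^sub>R Q v" if "0 < \<mu>" for \<mu> v
  proof -
    have "(\<Sum>i\<in>S. (c \<mu> i)\<^sup>2 *\<^sub>R jac \<psi> x (axis i 1) v) = A v"
      unfolding A_def using PN(3) by (intro sum.cong) (auto simp: c_def)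
    then show ?thesis
      unfolding jac_diff_cancel[of \<psi> x _ P N] PN using that by (simp add: jac_diff_def c_def Q_def)
  qed
  note full = dim_range_full_iff[OF linear_jac_diff[OF sm]]
  have "dim (range (jac_diff \<psi> x (c \<mu>) P N)) \<noteq> DIM(real^'n)"
    unfolding full using D[OF \<mu>(1)] \<mu>(3,4) by auto
  moreover have "dim (range (jac_diff \<psi> x (c \<mu>') P N)) = DIM(real^'n)"
    unfolding full using D[OF \<mu>(2)] \<mu>(5) by simp
  moreover have "\<forall>i. c \<mu> i \<noteq> 0" "\<forall>i. c \<mu>' i \<noteq> 0" using \<mu>(1,2) by (simp_all add: c_def)
  ultimately show ?thesis using that[OF P N] by metis
qed

lemma jac_diff_two_ranks:
  fixes \<psi> :: "real^'n::finite \<Rightarrow> real^'n^'n"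
  assumes \<psi>: "\<psi> \<in> Psi" and kl: "0 < k" "k \<le> l" "l < CARD('n)"
  obtains P N P' N' c c' where "card P = l" "card N = k" "card P' = l" "card N' = k"
    "\<forall>i. c i \<noteq> 0" "\<forall>i. c' i \<noteq> 0"
    "dim (range (jac_diff \<psi> x c P N)) \<noteq> dim (range (jac_diff \<psi> x c' P' N'))"
proof (cases "k = l")
  case True
  obtain P N where "card P = l" "card N = l"
    "dim (range (jac_diff \<psi> x (\<lambda>_. 1) P N)) \<noteq> dim (range (jac_diff \<psi> x (\<lambda>_. 1) N N))"
    using jac_diff_two_ranks_balanced[OF \<psi>] kl True by metis
  then show ?thesis using that[of P N N N "\<lambda>_. 1" "\<lambda>_. 1"] True by simp
next
  case False
  then have "k < l" using kl by simp
  from jac_diff_two_ranks_unbalanced[OF \<psi> kl(1) this kl(3)] show ?thesis using that by metis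
qed

lemma jordan_osserman_jac_diff_rank:
  fixes \<psi> :: "real^'n::finite \<Rightarrow> real^'n^'n"
  assumes \<psi>: "smooth_sym2_tensor \<psi>" and J: "jordan_osserman (g_psi \<psi>) r s"
    and card: "card N = r" "card P = s" "card N' = r" "card P' = s"
    and c: "\<And>i. c i \<noteq> 0" "\<And>i. c' i \<noteq> 0"
  shows "dim (range (jac_diff \<psi> 0 c P N)) = dim (range (jac_diff \<psi> 0 c' P' N'))"
proof -
  have "jacobi_sub (g_psi \<psi>) 0 (span (frame_set \<psi> 0 c P N)) = lower_block (jac_diff \<psi> 0 c P N)"
    if c: "\<And>i. c i \<noteq> 0" for c P N
  proof -
    have "orthonormal_basis (g_psi \<psi>) 0 (span (frame_set \<psi> 0 c P N)) (frame_set \<psi> 0 c P N)"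
      by (simp add: orthonormal_basis_iff frame_set_orthonormal(1)[where c = c, OF \<psi> c])
    moreover have "signed_jac \<psi> 0 (frame_set \<psi> 0 c P N) = jac_diff \<psi> 0 c P N"
      using signed_jac_frame_set[where c = c and z = 0, OF \<psi> c] by (simp add: fun_eq_iff jac_diff_def)
    ultimately show ?thesis using jacobi_sub_g_psi[OF \<psi>] by metis
  qed
  note js = this
  have "conjugate (jacobi_sub (g_psi \<psi>) 0 (span (frame_set \<psi> 0 c P N)))
      (jacobi_sub (g_psi \<psi>) 0 (span (frame_set \<psi> 0 c' P' N')))"
    using J frame_set_Gr[where c = c and z = 0 and P = P and N = N, OF \<psi> c(1)]
      frame_set_Gr[where c = c' and z = 0 and P = P' and N = N', OF \<psi> c(2)]
    unfolding jordan_osserman_def card by blast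
  then show ?thesis
    by (simp add: js c conjugate_lower_block_iff linear_jac_diff[OF \<psi>])
qed

lemma not_jordan_osserman_mixed:
  fixes \<psi> :: "real^'n::finite \<Rightarrow> real^'n^'n"
  assumes \<psi>: "\<psi> \<in> Psi" and rs: "0 < r" "r < CARD('n)" "0 < s" "s < CARD('n)"
  shows "\<not> jordan_osserman (g_psi \<psi>) r s"
proof
  assume J: "jordan_osserman (g_psi \<psi>) r s"
  note sm = Psi_smooth[OF \<psi>]
  have swap: "dim (range (jac_diff \<psi> 0 c P N)) = dim (range (jac_diff \<psi> 0 c N P))" for c P N
  proof -
    have "jac_diff \<psi> 0 c P N = (\<lambda>b. (- 1) *\<^sub>R jac_diff \<psi> 0 c N P b)"
      by (simp add: fun_eq_iff jac_diff_def)
    then show ?thesis using dim_range_scale[OF linear_jac_diff[OF sm], of "- 1"] by simp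
  qed
  show False
  proof (cases "r \<le> s")
    case True
    obtain P N P' N' c c' where "card P = s" "card N = r" "card P' = s" "card N' = r"
      "\<forall>i. c i \<noteq> 0" "\<forall>i. c' i \<noteq> 0"
      "dim (range (jac_diff \<psi> 0 c P N)) \<noteq> dim (range (jac_diff \<psi> 0 c' P' N'))"
      using jac_diff_two_ranks[OF \<psi> rs(1) True rs(4), of 0] .
    then show False using jordan_osserman_jac_diff_rank[OF sm J, of N P N' P' c c'] by simp
  next
    case False
    then have "s \<le> r" by simp
    obtain P N P' N' c c' where "card P = r" "card N = s" "card P' = r" "card N' = s"
      "\<forall>i. c i \<noteq> 0" "\<forall>i. c' i \<noteq> 0"
      "dim (range (jac_diff \<psi> 0 c P N)) \<noteq> dim (range (jac_diff \<psi> 0 c' P' N'))"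
      using jac_diff_two_ranks[OF \<psi> rs(3) \<open>s \<le> r\<close> rs(2), of 0] .
    then show False
      using jordan_osserman_jac_diff_rank[OF sm J, of P N P' N' c c'] by (simp add: swap[of _ P] swap[of _ P'])
  qed
qed

theorem theorem1p6:
  fixes \<psi> :: "real^'n::finite \<Rightarrow> real^'n^'n"
  assumes "CARD('n) \<ge> 2"
    and "smooth_sym2_tensor \<psi>"
  shows "(\<forall>k. 1 \<le> k \<and> k \<le> 2 * CARD('n) - 1 \<longrightarrow> k_osserman CARD('n) CARD('n) (g_psi \<psi>) k) \<and>
    (\<psi> \<in> Psi \<longrightarrow>
      (\<forall>r. 0 < r \<and> r \<le> CARD('n) \<longrightarrow>
         jordan_osserman (g_psi \<psi>) 0 r \<and>
         jordan_osserman (g_psi \<psi>) CARD('n) (CARD('n) - r) \<and>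
         jordan_osserman (g_psi \<psi>) r 0 \<and>
         jordan_osserman (g_psi \<psi>) (CARD('n) - r) CARD('n)) \<and>
      (\<forall>r s. 0 < r \<and> r < CARD('n) \<and> 0 < s \<and> s < CARD('n) \<longrightarrow>
         \<not> jordan_osserman (g_psi \<psi>) r s))"
proof (intro conjI impI allI)
  fix k
  show "k_osserman CARD('n) CARD('n) (g_psi \<psi>) k"
    unfolding k_osserman_def using osserman_g_psi[OF assms(2)] by blast
next
  fix r assume \<psi>: "\<psi> \<in> Psi" and r: "0 < r \<and> r \<le> CARD('n)"
  show "jordan_osserman (g_psi \<psi>) 0 r" "jordan_osserman (g_psi \<psi>) CARD('n) (CARD('n) - r)"
    "jordan_osserman (g_psi \<psi>) r 0" "jordan_osserman (g_psi \<psi>) (CARD('n) - r) CARD('n)"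
    by (rule jordan_osserman_definite[OF \<psi>, where k = r]; use r in simp)+
next
  fix r s assume "\<psi> \<in> Psi" "0 < r \<and> r < CARD('n) \<and> 0 < s \<and> s < CARD('n)"
  then show "\<not> jordan_osserman (g_psi \<psi>) r s" using not_jordan_osserman_mixed by blast
qed

end
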